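(* Let $G$ and $G'$ be connected undirected graphs. Then graphical maps $\varphi=(\varphi_0,\varphi_1)\colon G\to G'$ are the same thing as new graph maps $G\to G'$, that is, pairs $(\varphi_0,\hat\varphi)$ consisting of an involutive function $\varphi_0\colon A_G\to A_{G'}$ and a function $\hat\varphi\colon \mathrm{Emb}(G)\to\mathrm{Emb}(G')$ such that the pair is compatible with boundaries (condition (iv) of the context) and $\hat\varphi$ preserves edges, unions, and vertex disjoint pairs of embeddings (conditions (i), (ii), (iii) of the context). Precisely, there is a bijection between graphical maps $G\to G'$ and new graph maps $G\to G'$ which keeps the component $\varphi_0$ unchanged, and under these bijections composition of graphical maps corresponds to composition of pairs of functions. This holds uniformly for the graphical category $\mathbf U$ (no nodeless loops) and for the extended graphical category $\widetilde{\mathbf U}$ (where $G$ and/or $G'$ may be a nodeless loop).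
   Context: **Graphs.** An (ordinary) graph $G$ consists of finite sets $A_G$ (arcs) and $V_G$ (vertices), a fixpoint-free involution $a\mapsto a^\dagger$ on $A_G$, a subset $D_G\subseteq A_G$, and a function $t\colon D_G\to V_G$. For $v\in V_G$, $\mathrm{nb}(v)=t^{-1}(v)$; the boundary is $\partial(G)=A_G\setminus D_G$; edges are the $\dagger$-orbits $[a,a^\dagger]$. A graph is connected if it is non-empty and is not a disjoint union of two non-empty graphs. The edge $\updownarrow$ is the graph with two arcs interchanged by $\dagger$ and $D=V=\varnothing$. An étale map $f\colon H\to G$ consists of functions $A_H\to A_G$, $D_H\to D_G$, $V_H\to V_G$ (all written $f$) compatible with the involutions, the inclusions $D\subseteq A$ and $t$, such that $f$ restricts to a bijection $\mathrm{nb}(v)\to\mathrm{nb}(f(v))$ for each $v\in V_H$. An embedding is an étale map between connected graphs that is injective on vertices. $\mathrm{Emb}(G)$ is the set of classes $[f]$ of embeddings with codomain $G$, where $f\sim h$ iff $f=hz$ for an isomorphism $z$; it is partially ordered by $[h]\le[k]$ iff $h=kj$ for some embedding $j$. A class $[f]$ with $f\colon H\to G$ is called an edge if $H\cong\updownarrow$. For $v\in V_G$, $\iota_v\colon \star_v\to G$ is the embedding whose domain has vertex set $\{v\}$, $D_{\star_v}=\mathrm{nb}(v)$, arc set $\mathrm{nb}(v)\amalg\{b_d: d\in\mathrm{nb}(v)\}$ with $d^\dagger=b_d$, and $\iota_v(d)=d$, $\iota_v(b_d)=d^\dagger$; the assignment $v\mapsto[\iota_v]$ is an inclusion $V_G\hookrightarrow\mathrm{Emb}(G)$.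 $\mathbb NS$ is the free commutative monoid on a set $S$; for $S$ finite, the power set $\wp(S)$ is identified with the repetition-free elements. For an embedding $f\colon H\to G$ put $\varsigma[f]=f(V_H)\in\wp(V_G)\subseteq\mathbb NV_G$ and $\partial([f])=f(\partial(H))\in\wp(A_G)\subseteq\mathbb NA_G$ ($f$ is injective on $V_H$ and on $\partial(H)$). **Nodeless loop.** In the extended setting one allows one more connected graph $K$ (up to isomorphism), the nodeless loop, with $A_K=\{a,a^\dagger\}$, $D_K=V_K=\varnothing$, but with $\partial(K)=\varnothing$ by definition. The only embeddings with domain $K$ are isomorphisms of nodeless loops (involutive bijections on arcs); $\mathrm{Emb}(K)$ consists of exactly two elements $[\updownarrow]<[\mathrm{id}_K]$, with $\partial([\updownarrow])=A_K$, $\partial([\mathrm{id}_K])=\varnothing$; only the first one is an edge. **Graphical maps.** A graphical map $\varphi\colon G\to G'$ in $\mathbf U$ is a pair of an involutive function $\varphi_0\colon A_G\to A_{G'}$ (i.e. $\varphi_0(a^\dagger)=\varphi_0(a)^\dagger$) and a function $\varphi_1\colon V_G\to\mathrm{Emb}(G')$ such that: (a) $\sum_{v\in V_G}\varsigma(\varphi_1(v))\le\sum_{w\in V_{G'}}w$ in $\mathbb NV_{G'}$ (the sets $\varsigma(\varphi_1(v))$ are pairwise disjoint); (b) for each $v\in V_G$, $a\mapsto\varphi_0(a^\dagger)$ gives a bijection $\mathrm{nb}(v)\to\partial(\varphi_1(v))$; (c) if $\partial(G)=\varnothing$, then there is $v\in V_G$ with $\varphi_1(v)$ not an edge. In $\widetilde{\mathbf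 U}$, where nodeless loops are allowed, condition (c) is replaced by: (c') if $\partial(G)=\varnothing$ and $\varphi_1(v)$ is an edge for every $v\in V_G$, then $G'$ is a nodeless loop. For composable $\varphi\colon G\to G'$, $\psi\colon G'\to G''$, the composite has $(\psi\varphi)_0=\psi_0\varphi_0$, and $(\psi\varphi)_1(v)$ (defined in the literature via graph substitution) is the unique class in $\mathrm{Emb}(G'')$ with boundary $\psi_0(\partial(\varphi_1(v)))$ and vertex set $\coprod_{w\in\varsigma(\varphi_1(v))}\varsigma(\psi_1(w))$. Identities are $(\mathrm{id},v\mapsto[\iota_v])$. **New graph maps.** An embedding $\ell\colon L\to G$ is a union of embeddings $h\colon H\to G$ and $k\colon K\to G$ if $[h]\le[\ell]$, $[k]\le[\ell]$ and $\ell(V_L)=h(V_H)\cup k(V_K)$ (unions need not be unique). The embeddings $h,k$ are vertex disjoint if $h(V_H)\cap k(V_K)=\varnothing$. Both notions depend only on classes. A new graph map $G\to G'$ is a pair $(\varphi_0,\hat\varphi)$, with $\varphi_0\colon A_G\to A_{G'}$ involutive and $\hat\varphi\colon\mathrm{Emb}(G)\to\mathrm{Emb}(G')$, such that: (i) $\hat\varphi$ sends edges to edges; (ii) if $[\ell]$ is a union of $[h]$ and $[k]$, then $\hat\varphi[\ell]$ is a union of $\hat\varphi[h]$ and $\hat\varphi[k]$; (iii) $\hat\varphi$ takes vertex disjoint pairs to vertex disjoint pairs; (iv) $\partial(\hat\varphi[h])=(\mathbb N\varphi_0)(\partial[h])$ in $\mathbb NA_{G'}$ for all $[h]\in\mathrm{Emb}(G)$.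 Composition of new graph maps is composition of the two constituent functions. *)

theory Defs
  imports "HOL-Library.Multiset" "HOL-Library.FuncSet"
begin

section \<open>Graphs\<close>

text \<open>
  The boundary is a field of the record because it is what separates the nodeless loop from the
  ordinary graph consisting of a single edge: both have two arcs and no vertices, but the boundary
  of the former is empty by definition.
\<close>

record ('a, 'v) ugraph =
  arcs :: "'a set"
  dag :: "'a \<Rightarrow> 'a"
  darcs :: "'a set"
  verts :: "'v set"
  tgt :: "'a \<Rightarrow> 'v"
  bdy :: "'a set"

definition ordinary_graph :: "('a, 'v) ugraph \<Rightarrow> bool" where
  "ordinary_graph G \<longleftrightarrow>
     finite (arcs G) \<and> finite (verts G) \<and>
     (\<forall>a\<in>arcs G. dag G a \<in> arcs G \<and> dag G a \<noteq> a \<and> dag G (dag G a) = a) \<and>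
     darcs G \<subseteq> arcs G \<and> (\<forall>d\<in>darcs G. tgt G d \<in> verts G) \<and>
     bdy G = arcs G - darcs G"

definition nodeless_loop :: "('a, 'v) ugraph \<Rightarrow> bool" where
  "nodeless_loop G \<longleftrightarrow>
     (\<exists>a b. a \<noteq> b \<and> arcs G = {a, b} \<and> dag G a = b \<and> dag G b = a) \<and>
     darcs G = {} \<and> verts G = {} \<and> bdy G = {}"

definition nb :: "('a, 'v) ugraph \<Rightarrow> 'v \<Rightarrow> 'a set" where
  "nb G v = {d \<in> darcs G. tgt G d = v}"

definition graph_nonempty :: "('a, 'v) ugraph \<Rightarrow> bool" where
  "graph_nonempty G \<longleftrightarrow> arcs G \<noteq> {} \<or> verts G \<noteq> {}"

definition disjoint_union ::
    "('a, 'v) ugraph \<Rightarrow> ('a, 'v) ugraph \<Rightarrow> ('a, 'v) ugraph \<Rightarrow> bool" where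
  "disjoint_union G G1 G2 \<longleftrightarrow>
     arcs G = arcs G1 \<union> arcs G2 \<and> arcs G1 \<inter> arcs G2 = {} \<and>
     verts G = verts G1 \<union> verts G2 \<and> verts G1 \<inter> verts G2 = {} \<and>
     darcs G = darcs G1 \<union> darcs G2 \<and>
     (\<forall>a\<in>arcs G1. dag G a = dag G1 a) \<and> (\<forall>a\<in>arcs G2. dag G a = dag G2 a) \<and>
     (\<forall>d\<in>darcs G1. tgt G d = tgt G1 d) \<and> (\<forall>d\<in>darcs G2. tgt G d = tgt G2 d)"

definition connected_ordinary :: "('a, 'v) ugraph \<Rightarrow> bool" where
  "connected_ordinary G \<longleftrightarrow>
     ordinary_graph G \<and> graph_nonempty G \<and>
     \<not> (\<exists>G1 G2. ordinary_graph G1 \<and> ordinary_graph G2 \<and> graph_nonempty G1 \<and>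
           graph_nonempty G2 \<and> disjoint_union G G1 G2)"

definition connected_ext :: "('a, 'v) ugraph \<Rightarrow> bool" where
  "connected_ext G \<longleftrightarrow> connected_ordinary G \<or> nodeless_loop G"

definition edge_graph :: "(nat, nat) ugraph" where
  "edge_graph = \<lparr>arcs = {0, 1}, dag = (\<lambda>a. 1 - a), darcs = {}, verts = {},
                 tgt = (\<lambda>_. undefined), bdy = {0, 1}\<rparr>"

section \<open>Etale maps and embeddings\<close>

text \<open>
  A map is a pair of functions on arcs and on vertices; its component between the sets
  \<open>darcs\<close> is forced to be the restriction of the one on arcs.
  Functions matter only on the carriers of the domain, so maps are compared with \<open>agree\<close>.
\<close>

type_synonym ('a, 'v, 'b, 'w) gmap = "('a \<Rightarrow> 'b) \<times> ('v \<Rightarrow> 'w)"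

definition agree ::
    "('a, 'v) ugraph \<Rightarrow> ('a, 'v, 'b, 'w) gmap \<Rightarrow> ('a, 'v, 'b, 'w) gmap \<Rightarrow> bool" where
  "agree H f g \<longleftrightarrow>
     (\<forall>a\<in>arcs H. fst f a = fst g a) \<and> (\<forall>v\<in>verts H. snd f v = snd g v)"

definition gmap_comp ::
    "('b, 'w, 'c, 'x) gmap \<Rightarrow> ('a, 'v, 'b, 'w) gmap \<Rightarrow> ('a, 'v, 'c, 'x) gmap" where
  "gmap_comp g f = (fst g \<circ> fst f, snd g \<circ> snd f)"

definition etale ::
    "('a, 'v) ugraph \<Rightarrow> ('b, 'w) ugraph \<Rightarrow> ('a, 'v, 'b, 'w) gmap \<Rightarrow> bool" where
  "etale H G f \<longleftrightarrow>
     fst f \<in> arcs H \<rightarrow> arcs G \<and> fst f \<in> darcs H \<rightarrow> darcs G \<and> snd f \<in> verts H \<rightarrow> verts G \<and>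
     (\<forall>a\<in>arcs H. fst f (dag H a) = dag G (fst f a)) \<and>
     (\<forall>d\<in>darcs H. snd f (tgt H d) = tgt G (fst f d)) \<and>
     (\<forall>v\<in>verts H. bij_betw (fst f) (nb H v) (nb G (snd f v)))"

text \<open>
  An involutive function between two nodeless loops is automatically bijective, so the last
  condition allows exactly the isomorphisms of nodeless loops as embeddings with domain a
  nodeless loop.
\<close>

definition embedding ::
    "('a, 'v) ugraph \<Rightarrow> ('b, 'w) ugraph \<Rightarrow> ('a, 'v, 'b, 'w) gmap \<Rightarrow> bool" where
  "embedding H G f \<longleftrightarrow>
     connected_ext H \<and> connected_ext G \<and> etale H G f \<and> inj_on (snd f) (verts H) \<and>
     (nodeless_loop H \<longrightarrow> nodeless_loop G)"

text \<open>The clause on \<open>bdy\<close> is redundant between ordinary graphs.\<close>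

definition graph_iso ::
    "('a, 'v) ugraph \<Rightarrow> ('b, 'w) ugraph \<Rightarrow> ('a, 'v, 'b, 'w) gmap \<Rightarrow> bool" where
  "graph_iso H K z \<longleftrightarrow>
     etale H K z \<and> bij_betw (fst z) (arcs H) (arcs K) \<and> bij_betw (fst z) (darcs H) (darcs K) \<and>
     bij_betw (snd z) (verts H) (verts K) \<and> fst z ` bdy H = bdy K"

definition isomorphic :: "('a, 'v) ugraph \<Rightarrow> ('b, 'w) ugraph \<Rightarrow> bool" where
  "isomorphic H K \<longleftrightarrow> (\<exists>z. graph_iso H K z)"

section \<open>Classes of embeddings\<close>

text \<open>
  Since graphs are finite, every embedding is equivalent to one whose domain has natural numbers
  as arcs and vertices; the classes are formed from these.
\<close>

type_synonym ('a, 'v) emb_rep = "(nat, nat) ugraph \<times> (nat, nat, 'a, 'v) gmap"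
type_synonym ('a, 'v) emb_class = "('a, 'v) emb_rep set"

definition embeddings :: "('a, 'v) ugraph \<Rightarrow> ('a, 'v) emb_rep set" where
  "embeddings G = {(H, f). embedding H G f}"

definition emb_equiv :: "('a, 'v) ugraph \<Rightarrow> ('a, 'v) emb_rep rel" where
  "emb_equiv G = {((H, f), (K, h)). (H, f) \<in> embeddings G \<and> (K, h) \<in> embeddings G \<and>
                    (\<exists>z. graph_iso H K z \<and> agree H f (gmap_comp h z))}"

definition Emb :: "('a, 'v) ugraph \<Rightarrow> ('a, 'v) emb_class set" where
  "Emb G = embeddings G // emb_equiv G"

text \<open>
  In the next two definitions all members of a class contribute the same set, so the union is
  the common value; see \<open>emb_verts_class\<close> and \<open>emb_bdy_class\<close> below.
\<close>

definition emb_verts :: "('a, 'v) emb_class \<Rightarrow> 'v set" where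
  "emb_verts c = (\<Union>(H, f)\<in>c. snd f ` verts H)"

definition emb_bdy :: "('a, 'v) emb_class \<Rightarrow> 'a set" where
  "emb_bdy c = (\<Union>(H, f)\<in>c. fst f ` bdy H)"

definition is_edge :: "('a, 'v) emb_class \<Rightarrow> bool" where
  "is_edge c \<longleftrightarrow> (\<exists>(H, f)\<in>c. isomorphic H edge_graph)"

definition emb_le :: "('a, 'v) emb_class \<Rightarrow> ('a, 'v) emb_class \<Rightarrow> bool" where
  "emb_le c d \<longleftrightarrow>
     (\<exists>(H, h)\<in>c. \<exists>(K, k)\<in>d. \<exists>j. embedding H K j \<and> agree H h (gmap_comp k j))"

definition emb_union ::
    "('a, 'v) emb_class \<Rightarrow> ('a, 'v) emb_class \<Rightarrow> ('a, 'v) emb_class \<Rightarrow> bool" where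
  "emb_union l h k \<longleftrightarrow> emb_le h l \<and> emb_le k l \<and> emb_verts l = emb_verts h \<union> emb_verts k"

definition vertex_disjoint :: "('a, 'v) emb_class \<Rightarrow> ('a, 'v) emb_class \<Rightarrow> bool" where
  "vertex_disjoint h k \<longleftrightarrow> emb_verts h \<inter> emb_verts k = {}"

lemma emb_class_image:
  assumes "(H, f) \<in> embeddings G" and "(K, h) \<in> emb_equiv G `` {(H, f)}"
  shows "snd h ` verts K = snd f ` verts H" and "fst h ` bdy K = fst f ` bdy H"
proof -
  obtain z where z: "graph_iso H K z" and ag: "agree H f (gmap_comp h z)"
    using assms(2) by (auto simp: emb_equiv_def)
  have sub: "bdy H \<subseteq> arcs H"
    using assms(1) by (auto simp: embeddings_def embedding_def connected_ext_def
        connected_ordinary_def ordinary_graph_def nodeless_loop_def)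
  have "snd f ` verts H = snd h ` (snd z ` verts H)"
    using ag by (force simp: agree_def gmap_comp_def image_image)
  then show "snd h ` verts K = snd f ` verts H"
    using z by (simp add: graph_iso_def bij_betw_def)
  have "fst f ` bdy H = fst h ` (fst z ` bdy H)"
    using ag sub by (force simp: agree_def gmap_comp_def image_image)
  then show "fst h ` bdy K = fst f ` bdy H"
    using z by (simp add: graph_iso_def)
qed

lemma emb_class_self:
  assumes "(H, f) \<in> embeddings G"
  shows "(H, f) \<in> emb_equiv G `` {(H, f)}"
proof -
  have "graph_iso H H (id, id)"
    using assms by (auto simp: embeddings_def embedding_def graph_iso_def etale_def bij_betw_def)
  moreover have "agree H f (gmap_comp f (id, id))"
    by (simp add: agree_def gmap_comp_def)
  ultimately show ?thesis
    using assms unfolding emb_equiv_def by blast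
qed

lemma emb_verts_class:
  assumes "(H, f) \<in> embeddings G"
  shows "emb_verts (emb_equiv G `` {(H, f)}) = snd f ` verts H"
  unfolding emb_verts_def using emb_class_image(1)[OF assms] emb_class_self[OF assms] by blast

lemma emb_bdy_class:
  assumes "(H, f) \<in> embeddings G"
  shows "emb_bdy (emb_equiv G `` {(H, f)}) = fst f ` bdy H"
  unfolding emb_bdy_def using emb_class_image(2)[OF assms] emb_class_self[OF assms] by blast

section \<open>Graphical maps\<close>

text \<open>
  Functions on carriers are made extensional, so that equality of maps is equality in HOL.
  The free commutative monoid on a set is modelled by multisets, with \<open>mset_set\<close> the
  inclusion of the finite subsets and \<open>image_mset\<close> the functorial action.
\<close>

definition involutive_funs :: "('a, 'v) ugraph \<Rightarrow> ('b, 'w) ugraph \<Rightarrow> ('a \<Rightarrow> 'b) set" where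
  "involutive_funs G G' =
     {p \<in> arcs G \<rightarrow>\<^sub>E arcs G'. \<forall>a\<in>arcs G. p (dag G a) = dag G' (p a)}"

type_synonym ('a, 'v, 'b, 'w) graphical = "('a \<Rightarrow> 'b) \<times> ('v \<Rightarrow> ('b, 'w) emb_class)"

definition pre_graphical_maps ::
    "('a, 'v) ugraph \<Rightarrow> ('b, 'w) ugraph \<Rightarrow> ('a, 'v, 'b, 'w) graphical set" where
  "pre_graphical_maps G G' =
     {(p0, p1). p0 \<in> involutive_funs G G' \<and> p1 \<in> verts G \<rightarrow>\<^sub>E Emb G' \<and>
        (\<Sum>v\<in>verts G. mset_set (emb_verts (p1 v))) \<subseteq># mset_set (verts G') \<and>
        (\<forall>v\<in>verts G. bij_betw (\<lambda>a. p0 (dag G a)) (nb G v) (emb_bdy (p1 v)))}"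

definition graphical_maps_U ::
    "('a, 'v) ugraph \<Rightarrow> ('b, 'w) ugraph \<Rightarrow> ('a, 'v, 'b, 'w) graphical set" where
  "graphical_maps_U G G' =
     {(p0, p1) \<in> pre_graphical_maps G G'.
        bdy G = {} \<longrightarrow> (\<exists>v\<in>verts G. \<not> is_edge (p1 v))}"

definition graphical_maps_Ut ::
    "('a, 'v) ugraph \<Rightarrow> ('b, 'w) ugraph \<Rightarrow> ('a, 'v, 'b, 'w) graphical set" where
  "graphical_maps_Ut G G' =
     {(p0, p1) \<in> pre_graphical_maps G G'.
        bdy G = {} \<and> (\<forall>v\<in>verts G. is_edge (p1 v)) \<longrightarrow> nodeless_loop G'}"

definition graphical_comp ::
    "('a, 'v) ugraph \<Rightarrow> ('c, 'x) ugraph \<Rightarrow> ('b, 'w, 'c, 'x) graphical \<Rightarrow>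
     ('a, 'v, 'b, 'w) graphical \<Rightarrow> ('a, 'v, 'c, 'x) graphical" where
  "graphical_comp G G'' q p =
     (compose (arcs G) (fst q) (fst p),
      \<lambda>v\<in>verts G. THE c. c \<in> Emb G'' \<and>
         emb_bdy c = fst q ` emb_bdy (snd p v) \<and>
         emb_verts c = (\<Union>w\<in>emb_verts (snd p v). emb_verts (snd q w)))"

section \<open>New graph maps\<close>

type_synonym ('a, 'v, 'b, 'w) new_map =
  "('a \<Rightarrow> 'b) \<times> (('a, 'v) emb_class \<Rightarrow> ('b, 'w) emb_class)"

definition new_graph_maps ::
    "('a, 'v) ugraph \<Rightarrow> ('b, 'w) ugraph \<Rightarrow> ('a, 'v, 'b, 'w) new_map set" where
  "new_graph_maps G G' =
     {(p0, ph). p0 \<in> involutive_funs G G' \<and> ph \<in> Emb G \<rightarrow>\<^sub>E Emb G' \<and>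
        (\<forall>h\<in>Emb G. is_edge h \<longrightarrow> is_edge (ph h)) \<and>
        (\<forall>l\<in>Emb G. \<forall>h\<in>Emb G. \<forall>k\<in>Emb G.
            emb_union l h k \<longrightarrow> emb_union (ph l) (ph h) (ph k)) \<and>
        (\<forall>h\<in>Emb G. \<forall>k\<in>Emb G. vertex_disjoint h k \<longrightarrow> vertex_disjoint (ph h) (ph k)) \<and>
        (\<forall>h\<in>Emb G. mset_set (emb_bdy (ph h)) = image_mset p0 (mset_set (emb_bdy h)))}"

definition new_comp ::
    "('a, 'v) ugraph \<Rightarrow> ('b, 'w, 'c, 'x) new_map \<Rightarrow> ('a, 'v, 'b, 'w) new_map \<Rightarrow>
     ('a, 'v, 'c, 'x) new_map" where
  "new_comp G q p = (compose (arcs G) (fst q) (fst p), compose (Emb G) (snd q) (snd p))"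

end

theory Submission
  imports Defs
begin

text \<open>
  The class of an embedding is determined by its vertex set and its boundary, so both
  classes of embeddings and their order can be replaced by a combinatorial description of the
  pairs that occur. A class with at least one vertex arises from the star of any of its vertices
  by repeatedly gluing two boundary arcs to each other, or a boundary arc to the star of a new
  vertex, and each step is a union. Hence a new graph map is determined by
  its values on stars, and conversely a graphical map extends to all classes because the same
  gluings can be performed in the codomain. The only gluing that can fail there is that of the two
  ends of an edge, which needs the codomain to be a nodeless loop; it occurs only for a closed
  class all of whose vertices are sent to edges, that is, in the case of condition (c').
\<close>

section \<open>Connected graphs\<close>

text \<open>An embedding need not be injective on arcs: an edge with both ends in the image may
  still be cut, and then both of its arcs are hit twice. It is injective on arcs with a target, so
  reconstructions go through these, and a boundary arc is reached as the dagger of its partner. For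
  new graph maps the union axiom is needed for vertex sets, since (iv) already fixes boundaries.
  Gluing two boundary arcs of one class is a union of that class with itself, so the vertex set of
  the value does not change; gluing on a star adds the vertices of the value of the star. For
  graphical maps the gluings are repeated in \<open>G'\<close>, where stars may have become edges.
  There the injectivity of \<open>p0\<close> on the current boundary is carried along; it persists
  because the boundaries of the two pieces joined in \<open>G'\<close> stay disjoint. For an
  ordinary codomain (c) and (c') agree, so one argument covers both categories.\<close>

lemma connected_ext_cases:
  assumes "connected_ext G"
  obtains (ordinary) "connected_ordinary G" "\<not> nodeless_loop G" "ordinary_graph G"
  | (loop) "nodeless_loop G"
  using assms by (auto simp: connected_ext_def connected_ordinary_def)

lemma connected_extD:
  assumes "connected_ext G"
  shows "finite (arcs G)" "finite (verts G)" "bdy G \<subseteq> arcs G" "darcs G \<subseteq> arcs G"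
    and "a \<in> arcs G \<Longrightarrow> dag G a \<in> arcs G"
    and "a \<in> arcs G \<Longrightarrow> dag G a \<noteq> a"
    and "a \<in> arcs G \<Longrightarrow> dag G (dag G a) = a"
    and "d \<in> darcs G \<Longrightarrow> d \<in> arcs G"
    and "d \<in> darcs G \<Longrightarrow> tgt G d \<in> verts G"
    and "\<not> nodeless_loop G \<Longrightarrow> bdy G = arcs G - darcs G"
    and "verts G \<noteq> {} \<Longrightarrow> bdy G = arcs G - darcs G"
  using assms
  by (auto simp: connected_ext_def connected_ordinary_def ordinary_graph_def nodeless_loop_def)

lemma ordinary_not_loop: "ordinary_graph G \<Longrightarrow> \<not> nodeless_loop G"
  by (auto simp: ordinary_graph_def nodeless_loop_def)

text \<open>A pair closed under the involution and under incidence splits off as a disjoint summand,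
  its complement being the other one. This is the working form of connectedness, and it holds for
  the nodeless loop as well.\<close>

lemma connected_saturated:
  assumes "connected_ext G" and X: "X \<subseteq> arcs G" and Y: "Y \<subseteq> verts G"
    and dag: "\<And>a. a \<in> X \<Longrightarrow> dag G a \<in> X"
    and tgt: "\<And>d. d \<in> darcs G \<Longrightarrow> d \<in> X \<longleftrightarrow> tgt G d \<in> Y"
  shows "X = {} \<and> Y = {} \<or> X = arcs G \<and> Y = verts G"
  using assms(1)
proof (cases rule: connected_ext_cases)
  case ordinary
  note G = connected_extD[OF assms(1)]
  define part where "part X Y = G\<lparr>arcs := X, verts := Y, darcs := darcs G \<inter> X, bdy := X - darcs G\<rparr>"
    for X Y
  have "ordinary_graph (part X Y)"
    using G X Y dag tgt by (auto simp: part_def ordinary_graph_def intro: finite_subset)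
  moreover have "ordinary_graph (part (arcs G - X) (verts G - Y))"
    using G X Y dag tgt
    by (auto simp: part_def ordinary_graph_def intro: finite_subset) metis
  moreover have "disjoint_union G (part X Y) (part (arcs G - X) (verts G - Y))"
    using G X Y by (auto simp: part_def disjoint_union_def)
  ultimately have "\<not> graph_nonempty (part X Y) \<or>
      \<not> graph_nonempty (part (arcs G - X) (verts G - Y))"
    using ordinary(1) unfolding connected_ordinary_def by blast
  then show ?thesis
    using X Y by (auto simp: graph_nonempty_def part_def)
next
  case loop
  then obtain a b where "arcs G = {a, b}" "dag G a = b" "dag G b = a" "verts G = {}"
    by (auto simp: nodeless_loop_def)
  moreover have "X = {} \<or> X = {a, b}"
    using X dag[of a] dag[of b] calculation by auto
  ultimately show ?thesis
    using Y by auto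
qed

text \<open>Each summand of a disjoint decomposition is such a saturated pair. Used to check that
  explicitly built graphs are connected.\<close>

lemma connected_ordinaryI:
  assumes ord: "ordinary_graph G" and ne: "graph_nonempty G"
    and sat: "\<And>X Y. \<lbrakk>X \<subseteq> arcs G; Y \<subseteq> verts G; \<And>a. a \<in> X \<Longrightarrow> dag G a \<in> X;
          \<And>d. d \<in> darcs G \<Longrightarrow> d \<in> X \<longleftrightarrow> tgt G d \<in> Y\<rbrakk>
        \<Longrightarrow> X = {} \<and> Y = {} \<or> X = arcs G \<and> Y = verts G"
  shows "connected_ordinary G"
proof -
  have False if G1: "ordinary_graph G1" and G2: "ordinary_graph G2" and ne1: "graph_nonempty G1"
    and ne2: "graph_nonempty G2" and dis: "disjoint_union G G1 G2" for G1 G2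
  proof -
    have "arcs G1 = {} \<and> verts G1 = {} \<or> arcs G1 = arcs G \<and> verts G1 = verts G"
    proof (rule sat)
      show "arcs G1 \<subseteq> arcs G" "verts G1 \<subseteq> verts G"
        using dis by (auto simp: disjoint_union_def)
      show "dag G a \<in> arcs G1" if "a \<in> arcs G1" for a
        using that dis G1 by (auto simp: disjoint_union_def ordinary_graph_def)
      show "d \<in> arcs G1 \<longleftrightarrow> tgt G d \<in> verts G1" if d: "d \<in> darcs G" for d
      proof -
        consider "d \<in> darcs G1" | "d \<in> darcs G2"
          using d dis by (auto simp: disjoint_union_def)
        then show ?thesis
        proof cases
          case 1
          then show ?thesis
            using dis G1 by (auto simp: disjoint_union_def ordinary_graph_def)
        next
          case 2
          then have "d \<in> arcs G2" "tgt G d \<in> verts G2"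
            using dis G2 by (auto simp: disjoint_union_def ordinary_graph_def)
          then show ?thesis
            using dis by (auto simp: disjoint_union_def)
        qed
      qed
    qed
    then show False
      using ne1 ne2 dis by (auto simp: graph_nonempty_def disjoint_union_def)
  qed
  then show ?thesis
    using ord ne by (auto simp: connected_ordinary_def)
qed

text \<open>The two arcs of the edge form a saturated pair with no vertices, so they exhaust the
  connected graph.\<close>

lemma isolated_arc:
  assumes G: "connected_ext G" and a: "a \<in> arcs G" "a \<notin> darcs G" "dag G a \<notin> darcs G"
  shows "arcs G = {a, dag G a}" "verts G = {}"
proof -
  have "{a, dag G a} = {} \<and> {} = ({} :: 'b set) \<or> {a, dag G a} = arcs G \<and> {} = verts G"
    by (rule connected_saturated[OF G]) (use connected_extD(5,7)[OF G] a in auto)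
  then show "arcs G = {a, dag G a}" "verts G = {}"
    by auto
qed

lemma arc_or_dag_in_darcs:
  assumes G: "connected_ext G" and "verts G \<noteq> {}" and a: "a \<in> arcs G"
  shows "a \<in> darcs G \<or> dag G a \<in> darcs G"
  using isolated_arc[OF G a] assms(2) by blast

lemma vertexless:
  assumes G: "connected_ext G" and "verts G = {}"
  obtains a where "arcs G = {a, dag G a}" "a \<in> arcs G" "darcs G = {}"
    "bdy G = {} \<and> nodeless_loop G \<or> bdy G = arcs G \<and> \<not> nodeless_loop G"
  using G
proof (cases rule: connected_ext_cases)
  case loop
  then show ?thesis
    using that unfolding nodeless_loop_def by blast
next
  case ordinary
  then obtain a where a: "a \<in> arcs G"
    using assms(2) by (auto simp: connected_ordinary_def graph_nonempty_def)
  have d: "darcs G = {}"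
    using connected_extD(9)[OF G] assms(2) by auto
  then have "arcs G = {a, dag G a}"
    using isolated_arc(1)[OF G a] by simp
  then show ?thesis
    using that[of a] ordinary(2) a d connected_extD(10)[OF G] by simp
qed

lemma nodeless_loopI:
  assumes "connected_ext G" and "verts G = {}" and "bdy G = {}"
  shows "nodeless_loop G"
  by (rule vertexless[OF assms(1,2)]) (use assms(3) in auto)

section \<open>Shapes of embeddings\<close>

definition arcs_at :: "('a, 'v) ugraph \<Rightarrow> 'v set \<Rightarrow> 'a set" where
  "arcs_at G W = {d \<in> darcs G. tgt G d \<in> W}"

definition inner :: "('a, 'v) ugraph \<Rightarrow> 'v set \<Rightarrow> 'a set \<Rightarrow> 'a set" where
  "inner G W B = {d \<in> arcs_at G W. dag G d \<notin> B}"

definition support :: "('a, 'v) ugraph \<Rightarrow> 'v set \<Rightarrow> 'a set \<Rightarrow> 'a set" where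
  "support G W B =
     (if W \<noteq> {} then arcs_at G W \<union> dag G ` arcs_at G W else if B \<noteq> {} then B else arcs G)"

text \<open>
  These are the pairs \<open>(f(V), f(\<partial>))\<close> of embeddings \<open>f\<close> into \<open>G\<close>.
  The domain of \<open>f\<close> is recovered by cutting \<open>G\<close> open around \<open>W\<close> along the
  arcs in \<open>B\<close>, so the arcs in \<open>inner\<close> are those of the uncut edges, and
  \<open>support\<close> is the set of all arcs in the image. The last case of \<open>support\<close> is that
  of a nodeless loop.
\<close>

definition emb_shape :: "('a, 'v) ugraph \<Rightarrow> 'v set \<Rightarrow> 'a set \<Rightarrow> bool" where
  "emb_shape G W B \<longleftrightarrow>
     (if W = {} then B = {} \<and> nodeless_loop G \<or> (\<exists>a\<in>arcs G. B = {a, dag G a})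
      else W \<subseteq> verts G \<and> B \<subseteq> dag G ` arcs_at G W \<and>
        (\<forall>d\<in>inner G W B. dag G d \<in> inner G W B) \<and>
        (\<forall>W'. W' \<subset> W \<and> W' \<noteq> {} \<longrightarrow>
           (\<exists>d\<in>inner G W B. tgt G d \<in> W' \<and> tgt G (dag G d) \<notin> W')))"

text \<open>The order of \<open>Emb\<close> read on shapes. If \<open>W \<noteq> {}\<close>, the
  first two conditions imply the others. For an edge only the condition on \<open>support\<close>
  has content. The last conjunct keeps the identity of a nodeless loop, whose support is that of its
  edge, from lying below that edge.\<close>

definition shape_le ::
    "('a, 'v) ugraph \<Rightarrow> 'v set \<Rightarrow> 'a set \<Rightarrow> 'v set \<Rightarrow> 'a set \<Rightarrow> bool" where
  "shape_le G W B W' B' \<longleftrightarrow>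
     W \<subseteq> W' \<and> inner G W B \<subseteq> inner G W' B' \<and> support G W B \<subseteq> support G W' B' \<and>
     (W = {} \<and> B = {} \<longrightarrow> W' = {} \<and> B' = {})"

lemma shape_le_refl: "shape_le G W B W B"
  by (simp add: shape_le_def)

lemma shape_le_trans:
  "shape_le G W B W' B' \<Longrightarrow> shape_le G W' B' W'' B'' \<Longrightarrow> shape_le G W B W'' B''"
  by (auto simp: shape_le_def)

section \<open>From embeddings to shapes\<close>

lemma embeddingD:
  assumes "embedding H G f"
  shows "connected_ext H" "connected_ext G" "inj_on (snd f) (verts H)"
    and "nodeless_loop H \<Longrightarrow> nodeless_loop G"
    and "a \<in> arcs H \<Longrightarrow> fst f a \<in> arcs G"
    and "d \<in> darcs H \<Longrightarrow> fst f d \<in> darcs G"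
    and "v \<in> verts H \<Longrightarrow> snd f v \<in> verts G"
    and "a \<in> arcs H \<Longrightarrow> fst f (dag H a) = dag G (fst f a)"
    and "d \<in> darcs H \<Longrightarrow> tgt G (fst f d) = snd f (tgt H d)"
    and "v \<in> verts H \<Longrightarrow> bij_betw (fst f) (nb H v) (nb G (snd f v))"
  using assms unfolding embedding_def etale_def by auto

text \<open>Arcs with equal image have targets with equal image, so injectivity on vertices puts
  them into one \<open>nb H v\<close>, where the map is bijective.\<close>

lemma embedding_darcs:
  assumes f: "embedding H G f"
  shows "bij_betw (fst f) (darcs H) (arcs_at G (snd f ` verts H))"
proof -
  note f = embeddingD[OF f]
  note H = connected_extD[OF f(1)]
  have "inj_on (fst f) (darcs H)"
  proof (rule inj_onI)
    fix d e assume de: "d \<in> darcs H" "e \<in> darcs H" "fst f d = fst f e"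
    then have "tgt H d = tgt H e"
      using f(9)[of d] f(9)[of e] H(9) f(3) by (auto dest: inj_onD)
    then have "d \<in> nb H (tgt H d)" "e \<in> nb H (tgt H d)"
      using de by (auto simp: nb_def)
    then show "d = e"
      using f(10)[of "tgt H d"] de H(9) by (auto simp: bij_betw_def dest: inj_onD)
  qed
  moreover have "fst f ` darcs H = arcs_at G (snd f ` verts H)"
  proof
    show "fst f ` darcs H \<subseteq> arcs_at G (snd f ` verts H)"
      using f(6,9) H(9) by (auto simp: arcs_at_def)
    show "arcs_at G (snd f ` verts H) \<subseteq> fst f ` darcs H"
    proof
      fix a assume "a \<in> arcs_at G (snd f ` verts H)"
      then obtain v where v: "v \<in> verts H" "a \<in> nb G (snd f v)"
        by (auto simp: arcs_at_def nb_def)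
      then have "a \<in> fst f ` nb H v"
        using f(10) by (auto simp: bij_betw_def)
      then show "a \<in> fst f ` darcs H"
        by (auto simp: nb_def)
    qed
  qed
  ultimately show ?thesis
    by (simp add: bij_betw_def)
qed

lemma embedding_inner:
  assumes f: "embedding H G f"
  shows "inner G (snd f ` verts H) (fst f ` bdy H) = fst f ` {d \<in> darcs H. dag H d \<in> darcs H}"
    (is "?I = _")
proof (cases "verts H = {}")
  case True
  then show ?thesis
    using connected_extD(9)[OF embeddingD(1)[OF f]] by (auto simp: inner_def arcs_at_def)
next
  case False
  note bij = embedding_darcs[OF f]
  note f = embeddingD[OF f]
  note H = connected_extD[OF f(1)]
  \<comment> \<open>A boundary arc can have the same image as an arc with a target. Passing to the
    partners under the involution moves the comparison into \<open>darcs H\<close>, where the map is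
    injective.\<close>
  have key: "fst f (dag H d) \<in> fst f ` bdy H \<longleftrightarrow> dag H d \<in> bdy H" if d: "d \<in> darcs H" for d
  proof
    assume "fst f (dag H d) \<in> fst f ` bdy H"
    then obtain b where b: "b \<in> bdy H" "fst f (dag H d) = fst f b" by auto
    then have bH: "b \<in> arcs H" "dag H b \<in> darcs H"
      using arc_or_dag_in_darcs[OF f(1) False, of b] H(11)[OF False] by auto
    have "fst f (dag H b) = dag G (fst f (dag H d))"
      using b f(8) bH by simp
    also have "\<dots> = fst f d"
      using f(8) H d by (metis)
    finally have "dag H b = d"
      using bij bH d by (auto simp: bij_betw_def dest: inj_onD)
    then show "dag H d \<in> bdy H"
      using H(7)[OF bH(1)] b by simp
  qed auto
  have "?I = fst f ` {d \<in> darcs H. fst f (dag H d) \<notin> fst f ` bdy H}"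
    using bij f(8) H(8) by (force simp: inner_def bij_betw_def)
  also have "{d \<in> darcs H. fst f (dag H d) \<notin> fst f ` bdy H} = {d \<in> darcs H. dag H d \<in> darcs H}"
    using key H(11)[OF False] H(5,8) by auto
  finally show ?thesis .
qed

lemma embedding_support:
  assumes f: "embedding H G f"
  shows "support G (snd f ` verts H) (fst f ` bdy H) = fst f ` arcs H"
proof (cases "verts H = {}")
  case True
  note f = embeddingD[OF f]
  obtain a where a: "arcs H = {a, dag H a}" "a \<in> arcs H"
    "bdy H = {} \<and> nodeless_loop H \<or> bdy H = arcs H \<and> \<not> nodeless_loop H"
    using vertexless[OF f(1) True] by metis
  show ?thesis
  proof (cases "nodeless_loop H")
    case loop: True
    then obtain x y where xy: "arcs G = {x, y}" "dag G x = y" "dag G y = x"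
      using f(4) by (auto simp: nodeless_loop_def)
    have "fst f ` arcs H = {fst f a, dag G (fst f a)}"
      using f(8)[OF a(2)] a(1) by (metis image_insert image_empty)
    also have "\<dots> = arcs G"
    proof -
      have "fst f a = x \<or> fst f a = y"
        using f(5)[OF a(2)] xy(1) by simp
      then show ?thesis
        using xy by (elim disjE) (simp_all add: insert_commute)
    qed
    finally show ?thesis
      using True loop a by (auto simp: support_def)
  next
    case False
    then show ?thesis
      using True a by (auto simp: support_def)
  qed
next
  case False
  note bij = embedding_darcs[OF f]
  note f = embeddingD[OF f]
  note H = connected_extD[OF f(1)]
  have "a \<in> darcs H \<union> dag H ` darcs H" if "a \<in> arcs H" for a
    using arc_or_dag_in_darcs[OF f(1) False that] H(7)[OF that]
      imageI[of "dag H a" "darcs H" "dag H"] by auto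
  then have "arcs H = darcs H \<union> dag H ` darcs H"
    using H(5,8) by blast
  then have "fst f ` arcs H = fst f ` darcs H \<union> dag G ` fst f ` darcs H"
    using f(8) H(8) by (auto simp: image_image image_Un)
  then show ?thesis
    using bij False by (simp add: support_def bij_betw_def)
qed

lemma embedding_shape:
  assumes f: "embedding H G f"
  shows "emb_shape G (snd f ` verts H) (fst f ` bdy H)" (is "emb_shape G ?W ?B")
proof (cases "verts H = {}")
  case True
  note f = embeddingD[OF f]
  obtain a where a: "arcs H = {a, dag H a}" "a \<in> arcs H"
    "bdy H = {} \<and> nodeless_loop H \<or> bdy H = arcs H \<and> \<not> nodeless_loop H"
    using vertexless[OF f(1) True] by metis
  then have *: "fst f ` arcs H = {fst f a, dag G (fst f a)}"
    using f(8)[OF a(2)] by (metis image_insert image_empty)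
  show ?thesis
  proof (cases "nodeless_loop H")
    case True
    then show ?thesis
      using \<open>verts H = {}\<close> a f(4) by (simp add: emb_shape_def)
  next
    case False
    then have "fst f ` bdy H = {fst f a, dag G (fst f a)}"
      using a * by simp
    then show ?thesis
      using \<open>verts H = {}\<close> f(5)[OF a(2)] by (auto simp: emb_shape_def)
  qed
next
  case False
  note bij = embedding_darcs[OF f] and inner = embedding_inner[OF f]
  note f = embeddingD[OF f]
  note H = connected_extD[OF f(1)]
  have "?W \<subseteq> verts G"
    using f(7) by auto
  moreover have "?B \<subseteq> dag G ` arcs_at G ?W"
  proof
    fix x assume "x \<in> ?B"
    then obtain b where b: "b \<in> bdy H" "x = fst f b" by auto
    then have bH: "b \<in> arcs H" "dag H b \<in> darcs H"
      using arc_or_dag_in_darcs[OF f(1) False, of b] H(11)[OF False] by auto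
    have "x = dag G (fst f (dag H b))"
      using f(8) H(5,7) bH(1) b(2) by metis
    then show "x \<in> dag G ` arcs_at G ?W"
      using bij bH(2) by (auto simp: bij_betw_def)
  qed
  moreover have "\<forall>d\<in>inner G ?W ?B. dag G d \<in> inner G ?W ?B"
  proof -
    have "dag G (fst f d) \<in> fst f ` {d \<in> darcs H. dag H d \<in> darcs H}"
      if "d \<in> darcs H" "dag H d \<in> darcs H" for d
      using that f(8)[of d] H(7,8) by (intro image_eqI[of _ _ "dag H d"]) auto
    then show ?thesis
      unfolding inner by blast
  qed
  moreover have "\<exists>d\<in>inner G ?W ?B. tgt G d \<in> W' \<and> tgt G (dag G d) \<notin> W'"
    if W': "W' \<subset> ?W" "W' \<noteq> {}" for W'
  proof (rule ccontr)
    assume no: "\<not> ?thesis"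
    define Y where "Y = {v \<in> verts H. snd f v \<in> W'}"
    \<comment> \<open>All arcs of edges that meet \<open>Y\<close>. If no inner arc leaves
      \<open>W'\<close>, this pair is saturated, so \<open>Y\<close> is empty or everything, against
      the choice of \<open>W'\<close>.\<close>
    define X where "X = {a \<in> arcs H. a \<in> darcs H \<and> tgt H a \<in> Y \<or>
        dag H a \<in> darcs H \<and> tgt H (dag H a) \<in> Y}"
    have "X = {} \<and> Y = {} \<or> X = arcs H \<and> Y = verts H"
    proof (rule connected_saturated[OF f(1)])
      show "dag H a \<in> X" if "a \<in> X" for a
        using that H(5,7) by (auto simp: X_def)
      show "d \<in> X \<longleftrightarrow> tgt H d \<in> Y" if d: "d \<in> darcs H" for d
      proof
        assume "d \<in> X"
        show "tgt H d \<in> Y"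
        proof (rule ccontr)
          assume n: "tgt H d \<notin> Y"
          then have *: "dag H d \<in> darcs H" "tgt H (dag H d) \<in> Y"
            using \<open>d \<in> X\<close> by (auto simp: X_def)
          then have "fst f (dag H d) \<in> inner G ?W ?B"
            unfolding inner using d H(7,8) by auto
          moreover have "tgt G (fst f (dag H d)) \<in> W'"
            using * f(9) by (auto simp: Y_def)
          moreover have "tgt G (dag G (fst f (dag H d))) = snd f (tgt H d)"
            using f(8,9) d H(5,7,8) by metis
          ultimately show False
            using no n H(9)[OF d] by (auto simp: Y_def)
        qed
      qed (use d H(8) in \<open>auto simp: X_def\<close>)
    qed (auto simp: X_def Y_def)
    then show False
      using W' by (auto simp: Y_def)
  qed
  ultimately show ?thesis
    using False unfolding emb_shape_def by auto
qed

section \<open>Factorizations and isomorphisms of embeddings\<close>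

lemma bij_betw_factor:
  assumes k: "bij_betw k B C" and h: "bij_betw h A C" and j: "\<And>a. a \<in> A \<Longrightarrow> j a \<in> B \<and> k (j a) = h a"
  shows "bij_betw j A B"
proof -
  have "bij_betw (k \<circ> j) A C"
    using h j by (simp cong: bij_betw_cong)
  moreover have "j ` A \<subseteq> B"
    using j by auto
  ultimately show ?thesis
    using bij_betw_comp_iff2[OF k] by blast
qed

lemma embedding_darcs_inj:
  assumes "embedding H G f" and "d \<in> darcs H" and "e \<in> darcs H" and "fst f d = fst f e"
  shows "d = e"
  using embedding_darcs[OF assms(1)] assms(2-) by (meson bij_betw_def inj_onD)

lemma embedding_factors_iff:
  assumes h: "embedding H G h" and k: "embedding K G k"
  shows "(\<exists>j. embedding H K j \<and> agree H h (gmap_comp k j)) \<longleftrightarrow>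
    shape_le G (snd h ` verts H) (fst h ` bdy H) (snd k ` verts K) (fst k ` bdy K)"
    (is "?L \<longleftrightarrow> ?R")
proof
  assume ?L
  then obtain j where j: "embedding H K j" and ag: "agree H h (gmap_comp k j)"
    by blast
  note j = embeddingD[OF j]
  note H = connected_extD[OF j(1)]
  have hv: "snd h v = snd k (snd j v)" if "v \<in> verts H" for v
    using ag that by (simp add: agree_def gmap_comp_def)
  have ha: "fst h a = fst k (fst j a)" if "a \<in> arcs H" for a
    using ag that by (simp add: agree_def gmap_comp_def)
  have "snd h ` verts H \<subseteq> snd k ` verts K"
    using hv j(7) by auto
  moreover have "fst h ` arcs H \<subseteq> fst k ` arcs K"
    using ha j(5) by auto
  moreover have "fst h ` {d \<in> darcs H. dag H d \<in> darcs H} \<subseteq> fst k ` {d \<in> darcs K. dag K d \<in> darcs K}"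
  proof
    fix x assume "x \<in> fst h ` {d \<in> darcs H. dag H d \<in> darcs H}"
    then obtain d where d: "d \<in> darcs H" "dag H d \<in> darcs H" "x = fst k (fst j d)"
      using ha H(8) by auto
    then show "x \<in> fst k ` {d \<in> darcs K. dag K d \<in> darcs K}"
      using j(6)[of d] j(6)[of "dag H d"] j(8)[of d] H(8) by auto
  qed
  moreover have "snd k ` verts K = {} \<and> fst k ` bdy K = {}"
    if "snd h ` verts H = {} \<and> fst h ` bdy H = {}"
  proof -
    have "nodeless_loop H"
      using that nodeless_loopI[OF j(1)] by auto
    then show ?thesis
      using j(4) by (simp add: nodeless_loop_def)
  qed
  ultimately show ?R
    unfolding shape_le_def embedding_inner[OF h] embedding_inner[OF k]
      embedding_support[OF h] embedding_support[OF k] by blast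
next
  assume R: ?R
  note R = R[unfolded shape_le_def embedding_inner[OF h] embedding_inner[OF k]
      embedding_support[OF h] embedding_support[OF k]]
  note bijh = embedding_darcs[OF h] and bijk = embedding_darcs[OF k]
    and injk = embedding_darcs_inj[OF k]
  note h = embeddingD[OF h] and k = embeddingD[OF k]
  note H = connected_extD[OF h(1)] and K = connected_extD[OF k(1)]
  show ?L
  proof (cases "verts H = {}")
    case True
    then obtain a where a: "arcs H = {a, dag H a}" "a \<in> arcs H" "darcs H = {}"
      "bdy H = {} \<and> nodeless_loop H \<or> bdy H = arcs H \<and> \<not> nodeless_loop H"
      using vertexless[OF h(1)] by metis
    have "fst h a \<in> fst k ` arcs K"
      using R a(2) by blast
    then obtain b where b: "b \<in> arcs K" "fst h a = fst k b" by auto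
    define j where "j = (\<lambda>x. if x = a then b else dag K b, \<lambda>v. inv_into (verts K) (snd k) (snd h v))"
    have "nodeless_loop K" if "nodeless_loop H"
      using that R True nodeless_loopI[OF k(1)] by (auto simp: nodeless_loop_def)
    moreover have "dag H (dag H a) = a" "dag H a \<noteq> a" "dag K (dag K b) = b" "dag K b \<in> arcs K"
      using H K a b by auto
    ultimately have "embedding H K j"
      unfolding embedding_def etale_def using h(1) k(1) True a(1,3) b(1) by (auto simp: j_def)
    moreover have "agree H h (gmap_comp k j)"
      unfolding agree_def gmap_comp_def using True b a(1,2) h(8)[OF a(2)] k(8)[OF b(1)] H(6)[OF a(2)]
      by (auto simp: j_def)
    ultimately show ?thesis by blast
  next
    case False
    have bd: "bdy H = arcs H - darcs H"
      using H(11) False by simp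
    have bdD: "dag H b \<in> darcs H" if "b \<in> arcs H" "b \<notin> darcs H" for b
      using arc_or_dag_in_darcs[OF h(1) False] that by blast
    \<comment> \<open>An arc with a target has exactly one lift with a target. A boundary arc may
      have several preimages under \<open>k\<close>, so its value is the dagger of the lift of its
      partner.\<close>
    define ja where "ja d = inv_into (darcs K) (fst k) (fst h d)" for d
    define j where "j = (\<lambda>a. if a \<in> darcs H then ja a else dag K (ja (dag H a)),
        \<lambda>v. inv_into (verts K) (snd k) (snd h v))"
    have sub: "arcs_at G (snd h ` verts H) \<subseteq> arcs_at G (snd k ` verts K)"
      using R by (auto simp: arcs_at_def)
    have jd: "ja d \<in> darcs K" "fst k (ja d) = fst h d" if "d \<in> darcs H" for d
    proof -
      have "fst h d \<in> fst k ` darcs K"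
        using that sub bijh bijk by (auto simp: bij_betw_def)
      then show "ja d \<in> darcs K" "fst k (ja d) = fst h d"
        by (auto simp: ja_def inv_into_into f_inv_into_f)
    qed
    have jv: "snd j v \<in> verts K" "snd k (snd j v) = snd h v" if "v \<in> verts H" for v
    proof -
      have "snd h v \<in> snd k ` verts K"
        using that R by auto
      then show "snd j v \<in> verts K" "snd k (snd j v) = snd h v"
        by (auto simp: j_def inv_into_into f_inv_into_f)
    qed
    have jarc: "fst j a \<in> arcs K" "fst k (fst j a) = fst h a" if a: "a \<in> arcs H" for a
    proof -
      show "fst j a \<in> arcs K"
        using jd[of a] jd[of "dag H a"] K(5,8) bdD a by (auto simp: j_def)
      show "fst k (fst j a) = fst h a"
      proof (cases "a \<in> darcs H")
        case False
        then have *: "dag H a \<in> darcs H" using bdD a by auto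
        have "fst k (fst j a) = dag G (fst h (dag H a))"
          using False k(8) K(8) jd[OF *] by (simp add: j_def)
        also have "\<dots> = fst h a"
          using h(8)[of "dag H a"] H(5,7)[OF a] by simp
        finally show ?thesis .
      qed (simp add: j_def jd)
    qed
    have jdag: "fst j (dag H a) = dag K (fst j a)" if a: "a \<in> arcs H" for a
    proof -
      consider "a \<in> darcs H" "dag H a \<in> darcs H" | "a \<in> darcs H" "dag H a \<notin> darcs H"
        | "a \<notin> darcs H" "dag H a \<in> darcs H"
        using bdD a by blast
      then show ?thesis
      proof cases
        case 1
        \<comment> \<open>If both arcs of an edge carry targets, their lifts must form one edge of
          \<open>K\<close>; here the inclusion of inner arcs enters.\<close>
        then have "fst h a \<in> fst k ` {d \<in> darcs K. dag K d \<in> darcs K}"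
          using R by blast
        then obtain e where e: "e \<in> darcs K" "dag K e \<in> darcs K" "fst k e = fst h a"
          by auto
        then have "ja a = e"
          using jd[OF 1(1)] by (intro injk) simp_all
        moreover have "fst k (dag K e) = fst k (ja (dag H a))"
          using e k(8)[of e] K(8) jd[OF 1(2)] h(8)[OF a] by simp
        then have "dag K e = ja (dag H a)"
          by (intro injk e(2) jd(1)[OF 1(2)])
        ultimately show ?thesis
          using 1 by (simp add: j_def)
      next
        case 2
        then show ?thesis using H(7)[OF a] by (simp add: j_def)
      next
        case 3
        then show ?thesis using K(7,8) jd(1) by (simp add: j_def)
      qed
    qed
    have jtgt: "snd j (tgt H d) = tgt K (fst j d)" if d: "d \<in> darcs H" for d
    proof -
      have "snd k (tgt K (ja d)) = snd k (snd j (tgt H d))"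
        using d jd[OF d] k(9)[of "ja d"] h(9)[of d] jv(2)[of "tgt H d"] H(9) by simp
      then have "tgt K (ja d) = snd j (tgt H d)"
        by (rule inj_onD[OF k(3)]) (use d jd[OF d] K(9) jv(1) H(9) in auto)
      then show ?thesis
        using d by (simp add: j_def)
    qed
    have jnb: "bij_betw (fst j) (nb H v) (nb K (snd j v))" if v: "v \<in> verts H" for v
    proof (rule bij_betw_factor)
      show "bij_betw (fst k) (nb K (snd j v)) (nb G (snd h v))"
        using k(10)[OF jv(1)[OF v]] jv(2)[OF v] by simp
      show "bij_betw (fst h) (nb H v) (nb G (snd h v))"
        using h(10)[OF v] .
      show "fst j a \<in> nb K (snd j v) \<and> fst k (fst j a) = fst h a" if "a \<in> nb H v" for a
        using that jtgt[of a] jd[of a] by (auto simp: nb_def j_def)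
    qed
    have jinj: "inj_on (snd j) (verts H)"
      using h(3) jv(2) by (metis inj_on_def)
    have "embedding H K j"
      unfolding embedding_def etale_def
      using h(1) k(1) jinj jnb jtgt jdag jarc jv jd False
      by (auto simp: nodeless_loop_def) (simp add: j_def)
    moreover have "agree H h (gmap_comp k j)"
      unfolding agree_def gmap_comp_def using jarc jv by simp
    ultimately show ?thesis by blast
  qed
qed

text \<open>Equal shapes give a factorization \<open>j\<close> by reflexivity of
  \<open>shape_le\<close>. On vertices and on \<open>darcs\<close> it compares two bijections onto
  the same set, hence is bijective; what remains is that it respects boundaries.\<close>

lemma embeddings_equiv_iff:
  assumes h: "(H, h) \<in> embeddings G" and k: "(K, k) \<in> embeddings G"
  shows "((H, h), (K, k)) \<in> emb_equiv G \<longleftrightarrow>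
    snd h ` verts H = snd k ` verts K \<and> fst h ` bdy H = fst k ` bdy K" (is "?L \<longleftrightarrow> ?R")
proof
  assume ?L
  then show ?R
    using emb_class_image[OF h, of K k] by auto
next
  assume R: ?R
  have eh: "embedding H G h" and ek: "embedding K G k"
    using h k by (auto simp: embeddings_def)
  obtain j where j: "embedding H K j" and ag: "agree H h (gmap_comp k j)"
    using embedding_factors_iff[OF eh ek] R shape_le_refl by metis
  note bijh = embedding_darcs[OF eh] and bijk = embedding_darcs[OF ek]
    and innh = embedding_inner[OF eh] and innk = embedding_inner[OF ek]
  note h' = embeddingD[OF eh] and k' = embeddingD[OF ek] and j' = embeddingD[OF j]
  note H = connected_extD[OF h'(1)] and K = connected_extD[OF k'(1)]
  have hv: "snd h v = snd k (snd j v)" if "v \<in> verts H" for v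
    using ag that by (simp add: agree_def gmap_comp_def)
  have ha: "fst h a = fst k (fst j a)" if "a \<in> arcs H" for a
    using ag that by (simp add: agree_def gmap_comp_def)
  have bv: "bij_betw (snd j) (verts H) (verts K)"
    by (rule bij_betw_factor[of "snd k" _ "snd k ` verts K" "snd h"])
      (use R h'(3) k'(3) hv j'(7) in \<open>auto simp: bij_betw_def\<close>)
  have bd: "bij_betw (fst j) (darcs H) (darcs K)"
    by (rule bij_betw_factor[of "fst k" _ "arcs_at G (snd k ` verts K)" "fst h"])
      (use R bijh bijk ha j'(6) H(8) in \<open>auto\<close>)
  have "bij_betw (fst j) (arcs H) (arcs K) \<and> fst j ` bdy H = bdy K"
  proof (cases "verts H = {}")
    case True
    then have "verts K = {}" using R by auto
    obtain a where a: "arcs H = {a, dag H a}" "a \<in> arcs H"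
      "bdy H = {} \<and> nodeless_loop H \<or> bdy H = arcs H \<and> \<not> nodeless_loop H"
      using vertexless[OF h'(1) True] by metis
    obtain b where b: "arcs K = {b, dag K b}" "b \<in> arcs K"
      "bdy K = {} \<and> nodeless_loop K \<or> bdy K = arcs K \<and> \<not> nodeless_loop K"
      using vertexless[OF k'(1) \<open>verts K = {}\<close>] by metis
    have "fst j a \<in> {b, dag K b}" "fst j (dag H a) = dag K (fst j a)"
      using j'(5)[OF a(2)] j'(8)[OF a(2)] b(1) by auto
    moreover have "dag K b \<noteq> b" "dag K (dag K b) = b" "dag H a \<noteq> a"
      using K(6,7)[OF b(2)] H(6)[OF a(2)] by auto
    ultimately have "inj_on (fst j) {a, dag H a}" and im: "fst j ` {a, dag H a} = {b, dag K b}"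
      by auto
    then have "bij_betw (fst j) (arcs H) (arcs K)"
      unfolding bij_betw_def a(1)[symmetric] b(1)[symmetric] by auto
    moreover have "bdy H = {} \<longleftrightarrow> bdy K = {}"
      using R by (metis image_is_empty)
    then have "fst j ` bdy H = bdy K"
      using im a(2,3) b(2,3) unfolding a(1)[symmetric] b(1)[symmetric] by auto
    ultimately show ?thesis by blast
  next
    case False
    then have False': "verts K \<noteq> {}" using R by auto
    \<comment> \<open>Otherwise the partner of \<open>b\<close> would be inner for \<open>K\<close>,
      hence also for \<open>H\<close> because the shapes agree, although \<open>b\<close> is a
      boundary arc.\<close>
    have fwd: "fst j b \<in> bdy K" if b: "b \<in> bdy H" for b
    proof (rule ccontr)
      have bH: "b \<in> arcs H" "b \<notin> darcs H" "dag H b \<in> darcs H"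
        using b H(11)[OF False] arc_or_dag_in_darcs[OF h'(1) False, of b] by auto
      assume "fst j b \<notin> bdy K"
      then have "fst j b \<in> darcs K"
        using K(11)[OF False'] j'(5) bH by auto
      moreover have "dag K (fst j (dag H b)) = fst j b"
        using j'(8)[of "dag H b"] H(5,7)[OF bH(1)] by simp
      ultimately have "fst k (fst j (dag H b)) \<in> fst k ` {d \<in> darcs K. dag K d \<in> darcs K}"
        using j'(6)[OF bH(3)] by auto
      then have "fst h (dag H b) \<in> fst h ` {d \<in> darcs H. dag H d \<in> darcs H}"
        using innh innk R ha[of "dag H b"] H(5)[OF bH(1)] by simp
      then have "dag H b \<in> {d \<in> darcs H. dag H d \<in> darcs H}"
        using embedding_darcs_inj[OF eh bH(3)] by auto
      then show False
        using bH H(7) by simp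
    qed
    have bwd: "c \<in> fst j ` bdy H" if c: "c \<in> bdy K" for c
    proof -
      have cK: "c \<in> arcs K" "c \<notin> darcs K" "dag K c \<in> darcs K"
        using c K(11)[OF False'] arc_or_dag_in_darcs[OF k'(1) False', of c] by auto
      then have "dag K c \<in> fst j ` darcs H"
        using bd by (simp add: bij_betw_def)
      then obtain d where d: "d \<in> darcs H" "fst j d = dag K c"
        by auto
      then have "fst j (dag H d) = c"
        using j'(8)[of d] H(8) K(7)[OF cK(1)] by simp
      moreover from this have "dag H d \<in> bdy H"
        using H(11)[OF False] H(5,8) d cK(2) j'(6) by auto
      ultimately show ?thesis by auto
    qed
    have im: "fst j ` bdy H = bdy K"
      using fwd bwd by auto
    have "inj_on (fst j) (bdy H)"
    proof (rule inj_onI)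
      fix b c assume bc: "b \<in> bdy H" "c \<in> bdy H" "fst j b = fst j c"
      then have *: "b \<in> arcs H" "dag H b \<in> darcs H" "c \<in> arcs H" "dag H c \<in> darcs H"
        using H(11)[OF False] arc_or_dag_in_darcs[OF h'(1) False] by auto
      have "fst j (dag H b) = fst j (dag H c)"
        using j'(8) * bc(3) by simp
      then have "dag H b = dag H c"
        using bd * unfolding bij_betw_def by (meson inj_onD)
      then show "b = c"
        using H(7) * by metis
    qed
    then have "bij_betw (fst j) (bdy H) (bdy K)"
      using im by (simp add: bij_betw_def)
    moreover have "arcs H = darcs H \<union> bdy H" "arcs K = darcs K \<union> bdy K"
      "darcs K \<inter> bdy K = {}"
      using H(4) H(11)[OF False] K(4) K(11)[OF False'] by auto
    ultimately show ?thesis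
      using bij_betw_combine[OF bd] im by metis
  qed
  then have "graph_iso H K j"
    using j bv bd by (simp add: graph_iso_def embedding_def)
  then show ?L
    using h k ag unfolding emb_equiv_def by blast
qed

section \<open>Realizing every shape by an embedding\<close>

lemma arcs_edge_graph [simp]:
  "arcs edge_graph = {0, 1}" "dag edge_graph a = 1 - a" "darcs edge_graph = {}"
  "verts edge_graph = {}" "bdy edge_graph = {0, 1}"
  by (simp_all add: edge_graph_def)

lemma connected_edge_graph: "connected_ordinary edge_graph"
proof (rule connected_ordinaryI)
  fix X Y
  assume "X \<subseteq> arcs edge_graph" "Y \<subseteq> verts edge_graph" and
    dag: "\<And>a. a \<in> X \<Longrightarrow> dag edge_graph a \<in> X"
  then show "X = {} \<and> Y = {} \<or> X = arcs edge_graph \<and> Y = verts edge_graph"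
    using dag[of 0] dag[of 1] by auto
qed (auto simp: ordinary_graph_def graph_nonempty_def)

lemma nodeless_loop_edge_graph: "nodeless_loop (edge_graph\<lparr>bdy := {}\<rparr>)"
  by (auto simp: nodeless_loop_def intro!: exI[of _ 0] exI[of _ 1])

lemma not_nodeless_loop_edge_graph: "\<not> nodeless_loop edge_graph"
  by (simp add: nodeless_loop_def)

lemma embedding_edge:
  assumes G: "connected_ext G" and a: "a \<in> arcs G"
  defines "f \<equiv> (\<lambda>n. if n = 0 then a else dag G a, \<lambda>_. undefined)"
  shows "embedding edge_graph G f"
    and "nodeless_loop G \<Longrightarrow> embedding (edge_graph\<lparr>bdy := {}\<rparr>) G f"
  using connected_edge_graph not_nodeless_loop_edge_graph nodeless_loop_edge_graph G a
    connected_extD[OF G]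
  by (auto simp: f_def embedding_def etale_def connected_ext_def)

text \<open>
  The arcs of the model are \<open>i d\<close> for the arcs \<open>d\<close> at \<open>W\<close>, and a boundary
  arc \<open>b d\<close> opposite to \<open>i d\<close> when \<open>d\<close> is not inner.
\<close>

lemma embedding_of_proper_shape:
  fixes G :: "('a, 'v) ugraph"
  assumes G: "connected_ext G" and sh: "emb_shape G W B" and ne: "W \<noteq> {}"
  shows "\<exists>(H, f) \<in> embeddings G. snd f ` verts H = W \<and> fst f ` bdy H = B"
proof -
  note G' = connected_extD[OF G]
  have W: "W \<subseteq> verts G" and B: "B \<subseteq> dag G ` arcs_at G W"
    and innd: "\<And>d. d \<in> inner G W B \<Longrightarrow> dag G d \<in> inner G W B"
    and conn: "\<And>W'. W' \<subset> W \<Longrightarrow> W' \<noteq> {} \<Longrightarrow>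
      \<exists>d\<in>inner G W B. tgt G d \<in> W' \<and> tgt G (dag G d) \<notin> W'"
    using sh ne by (auto simp: emb_shape_def)
  define D where "D = arcs_at G W"
  define S where "S = inner G W B"
  have SD: "S \<subseteq> D" and Dd: "D \<subseteq> darcs G" and DG: "D \<subseteq> arcs G"
    and DW: "\<And>d. d \<in> D \<Longrightarrow> tgt G d \<in> W"
    using G'(4) by (auto simp: S_def inner_def D_def arcs_at_def)
  have B_eq: "B = dag G ` (D - S)"
    using B DG G'(7) by (auto simp: S_def D_def inner_def)
  obtain e :: "'a \<Rightarrow> nat" where e: "inj_on e (arcs G)"
    using finite_imp_inj_to_nat_seg[OF G'(1)] by metis
  obtain u :: "'v \<Rightarrow> nat" where u: "inj_on u (verts G)"
    using finite_imp_inj_to_nat_seg[OF G'(2)] by metis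
  \<comment> \<open>Parity separates arcs with a target from boundary arcs, and halving recovers the
    arc of \<open>G\<close>. Thus the new arcs never clash, even when \<open>d\<close> and
    \<open>dag G d\<close> are both at \<open>W\<close> and their edge is cut.\<close>
  define i where "i d = 2 * e d" for d
  define b where "b d = Suc (2 * e d)" for d
  define g where "g n = inv_into (arcs G) e (n div 2)" for n
  define w where "w = inv_into (verts G) u"
  have gi [simp]: "g (i d) = d" "g (b d) = d" if "d \<in> D" for d
    using that e DG by (auto simp: g_def i_def b_def)
  have wu [simp]: "w (u v) = v" if "v \<in> W" for v
    using that u W by (auto simp: w_def)
  have ib [simp]: "i d \<noteq> b d'" "b d' \<noteq> i d" for d d'
    unfolding i_def b_def by presburger+
  have i_inj [simp]: "i d = i d' \<longleftrightarrow> d = d'" if "d \<in> D" "d' \<in> D" for d d'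
    using gi that by metis
  have b_inj [simp]: "b d = b d' \<longleftrightarrow> d = d'" if "d \<in> D" "d' \<in> D" for d d'
    using gi that by metis
  have u_inj [simp]: "u v = u v' \<longleftrightarrow> v = v'" if "v \<in> W" "v' \<in> W" for v v'
    using wu that by metis
  have i_img [simp]: "i d \<in> i ` X \<longleftrightarrow> d \<in> X" if "d \<in> D" "X \<subseteq> D" for d X
    using that by (auto simp: image_iff subset_iff)
  have b_img [simp]: "b d \<in> b ` X \<longleftrightarrow> d \<in> X" if "d \<in> D" "X \<subseteq> D" for d X
    using that by (auto simp: image_iff subset_iff)
  define H where "H = \<lparr>arcs = i ` D \<union> b ` (D - S),
      dag = \<lambda>n. if even n then (if g n \<in> S then i (dag G (g n)) else b (g n)) else i (g n),
      darcs = i ` D, verts = u ` W, tgt = \<lambda>n. u (tgt G (g n)), bdy = b ` (D - S)\<rparr>"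
  define f where "f = (\<lambda>n. if even n then g n else dag G (g n), w)"
  have ev [simp]: "even (i d)" "odd (b d)" for d
    by (simp_all add: i_def b_def)
  have H [simp]: "arcs H = i ` D \<union> b ` (D - S)" "darcs H = i ` D" "verts H = u ` W"
    "bdy H = b ` (D - S)"
    by (simp_all add: H_def)
  have dagS: "dag H (i d) = i (dag G d)" "dag G d \<in> S" "dag G d \<in> D"
    "dag G d \<noteq> d" "dag G (dag G d) = d" if "d \<in> S" for d
    using that SD DG innd G'(6,7) by (auto simp: H_def S_def subset_iff)
  have dagD: "dag H (i d) = b d" "dag H (b d) = i d" if "d \<in> D" "d \<notin> S" for d
    using that by (auto simp: H_def)
  have tgtH: "tgt H (i d) = u (tgt G d)" if "d \<in> D" for d
    using that by (simp add: H_def)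
  have fH: "fst f (i d) = d" "fst f (b d) = dag G d" if "d \<in> D" for d
    using that by (simp_all add: f_def)
  have fv: "snd f (u v) = v" if "v \<in> W" for v
    using that by (simp add: f_def)
  have arc_cases: thesis
    if "n \<in> arcs H" and "\<And>d. n = i d \<Longrightarrow> d \<in> S \<Longrightarrow> thesis"
      "\<And>d. n = i d \<Longrightarrow> d \<in> D \<Longrightarrow> d \<notin> S \<Longrightarrow> thesis"
      "\<And>d. n = b d \<Longrightarrow> d \<in> D \<Longrightarrow> d \<notin> S \<Longrightarrow> thesis" for n thesis
    using that by auto
  have "ordinary_graph H"
    unfolding ordinary_graph_def
  proof (intro conjI ballI)
    have "finite D"
      using DG G'(1) finite_subset by blast
    then show "finite (arcs H)" by simp
    show "finite (verts H)"
      using W G'(2) finite_subset by auto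
    show "dag H n \<in> arcs H" if "n \<in> arcs H" for n
      by (rule arc_cases[OF that]) (auto simp: dagS dagD)
    show "dag H n \<noteq> n" if "n \<in> arcs H" for n
      by (rule arc_cases[OF that]) (use SD in \<open>auto simp: dagS dagD subset_iff\<close>)
    show "dag H (dag H n) = n" if "n \<in> arcs H" for n
      by (rule arc_cases[OF that]) (auto simp: dagS dagD)
    show "tgt H n \<in> verts H" if "n \<in> darcs H" for n
      using that DW by (auto simp: tgtH)
    show "bdy H = arcs H - darcs H"
      by auto
  qed auto
  moreover have "graph_nonempty H"
    using ne by (simp add: graph_nonempty_def)
  moreover have "X = {} \<and> Y = {} \<or> X = arcs H \<and> Y = verts H"
    if X: "X \<subseteq> arcs H" and Y: "Y \<subseteq> verts H" and dag: "\<And>a. a \<in> X \<Longrightarrow> dag H a \<in> X"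
      and tgt: "\<And>d. d \<in> darcs H \<Longrightarrow> d \<in> X \<longleftrightarrow> tgt H d \<in> Y" for X Y
  proof -
    \<comment> \<open>The saturated pair is governed by its vertices; if \<open>W'\<close> were
      non-trivial, the inner arc leaving it would contradict saturation.\<close>
    define W' where "W' = {v \<in> W. u v \<in> Y}"
    have YW: "Y = u ` W'"
      using Y by (auto simp: W'_def)
    have iX: "i d \<in> X \<longleftrightarrow> tgt G d \<in> W'" if "d \<in> D" for d
      using tgt[of "i d"] that DW by (simp add: tgtH W'_def)
    have bX: "b d \<in> X \<longleftrightarrow> tgt G d \<in> W'" if "d \<in> D" "d \<notin> S" for d
      using dag[of "i d"] dag[of "b d"] dagD[OF that] iX[OF that(1)] by auto
    have "W' = {} \<or> W' = W"
    proof (rule ccontr)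
      assume "\<not> ?thesis"
      then obtain d where d: "d \<in> S" "tgt G d \<in> W'" "tgt G (dag G d) \<notin> W'"
        using conn[of W'] by (auto simp: W'_def S_def)
      then show False
        using dag[of "i d"] iX[of d] iX[of "dag G d"] dagS[OF d(1)] SD by auto
    qed
    then show ?thesis
    proof
      assume "W' = {}"
      then show ?thesis
        using X YW iX bX by (auto elim!: arc_cases)
    next
      assume "W' = W"
      then have "arcs H \<subseteq> X"
        using iX bX DW by auto
      then show ?thesis
        using X YW \<open>W' = W\<close> by auto
    qed
  qed
  ultimately have HC: "connected_ordinary H"
    by (rule connected_ordinaryI)
  have nl: "\<not> nodeless_loop H"
    using ne by (simp add: nodeless_loop_def)
  have "etale H G f"
    unfolding etale_def
  proof (intro conjI ballI)
    show "fst f \<in> arcs H \<rightarrow> arcs G"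
      using DG G'(5) by (auto simp: fH)
    show "fst f \<in> darcs H \<rightarrow> darcs G"
      using Dd by (auto simp: fH)
    show "snd f \<in> verts H \<rightarrow> verts G"
      using W by (auto simp: fv)
    show "fst f (dag H n) = dag G (fst f n)" if "n \<in> arcs H" for n
      by (rule arc_cases[OF that]) (use SD DG G'(7) in \<open>auto simp: dagS dagD fH subset_iff\<close>)
    show "snd f (tgt H n) = tgt G (fst f n)" if "n \<in> darcs H" for n
      using that DW by (auto simp: tgtH fH fv)
    show "bij_betw (fst f) (nb H v) (nb G (snd f v))" if v: "v \<in> verts H" for v
    proof (rule bij_betw_byWitness[where f' = i])
      obtain x where x: "x \<in> W" "v = u x" using v by auto
      show "\<forall>a\<in>nb H v. i (fst f a) = a"
        by (auto simp: nb_def fH)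
      show "\<forall>a\<in>nb G (snd f v). fst f (i a) = a"
        using x by (auto simp: nb_def fH fv D_def arcs_at_def)
      show "fst f ` nb H v \<subseteq> nb G (snd f v)"
        using x Dd DW by (auto simp: nb_def fH fv tgtH)
      show "i ` nb G (snd f v) \<subseteq> nb H v"
        using x by (auto simp: nb_def fv tgtH D_def arcs_at_def)
    qed
  qed
  moreover have "inj_on (snd f) (verts H)"
    by (rule inj_onI) (auto simp: fv)
  ultimately have "(H, f) \<in> embeddings G"
    using HC nl G by (simp add: embeddings_def embedding_def connected_ext_def)
  moreover have "snd f ` verts H = W"
    by (auto simp: image_image fv)
  moreover have "fst f ` bdy H = B"
    by (auto simp: image_image fH B_eq)
  ultimately show ?thesis
    by blast
qed

lemma embedding_of_shape:
  assumes G: "connected_ext G" and sh: "emb_shape G W B"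
  shows "\<exists>(H, f) \<in> embeddings G. snd f ` verts H = W \<and> fst f ` bdy H = B"
proof (cases "W = {}")
  case True
  then consider "B = {}" "nodeless_loop G" | a where "a \<in> arcs G" "B = {a, dag G a}"
    using sh by (auto simp: emb_shape_def)
  then show ?thesis
  proof cases
    case 1
    then obtain a where "a \<in> arcs G"
      unfolding nodeless_loop_def by blast
    then show ?thesis
      using embedding_edge(2)[OF G _ 1(2)] 1 True unfolding embeddings_def by fastforce
  next
    case 2
    then show ?thesis
      using embedding_edge(1)[OF G] True unfolding embeddings_def by fastforce
  qed
qed (use embedding_of_proper_shape assms in blast)

section \<open>Classes of embeddings as shapes\<close>

lemma Emb_memE:
  assumes "c \<in> Emb G"
  obtains H f where "(H, f) \<in> embeddings G" "(H, f) \<in> c" "c = emb_equiv G `` {(H, f)}"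
    "emb_verts c = snd f ` verts H" "emb_bdy c = fst f ` bdy H"
proof -
  obtain p where p: "p \<in> embeddings G" "c = emb_equiv G `` {p}"
    using assms by (auto simp: Emb_def elim: quotientE)
  obtain H f where "p = (H, f)" by (cases p)
  then show thesis
    using that[of H f] p emb_verts_class emb_bdy_class emb_class_self by metis
qed

lemma Emb_member:
  assumes c: "c \<in> Emb G" and K: "(K, k) \<in> c"
  shows "embedding K G k" "snd k ` verts K = emb_verts c" "fst k ` bdy K = emb_bdy c"
proof -
  obtain H f where H: "(H, f) \<in> embeddings G" "c = emb_equiv G `` {(H, f)}"
    "emb_verts c = snd f ` verts H" "emb_bdy c = fst f ` bdy H"
    using Emb_memE[OF c] by metis
  then show "embedding K G k" "snd k ` verts K = emb_verts c" "fst k ` bdy K = emb_bdy c"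
    using K emb_class_image[OF H(1), of K k] by (auto simp: emb_equiv_def embeddings_def)
qed

lemma Emb_shape:
  assumes "c \<in> Emb G"
  shows "emb_shape G (emb_verts c) (emb_bdy c)"
  using Emb_memE[OF assms] Emb_member[OF assms] embedding_shape by metis

text \<open>Equivalence of embeddings is equality of shapes, so a class consists of exactly the
  representatives with its vertex set and boundary.\<close>

lemma Emb_eqI:
  assumes c: "c \<in> Emb G" and d: "d \<in> Emb G"
    and eq: "emb_verts c = emb_verts d" "emb_bdy c = emb_bdy d"
  shows "c = d"
proof -
  have *: "c = {(K, k) \<in> embeddings G. snd k ` verts K = emb_verts c \<and> fst k ` bdy K = emb_bdy c}"
    if c: "c \<in> Emb G" for c
  proof -
    obtain H f where H: "(H, f) \<in> embeddings G" "c = emb_equiv G `` {(H, f)}"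
      "emb_verts c = snd f ` verts H" "emb_bdy c = fst f ` bdy H"
      using Emb_memE[OF c] by metis
    show ?thesis
    proof (intro set_eqI iffI)
      fix p assume "p \<in> c"
      moreover obtain K k where "p = (K, k)" by (cases p)
      ultimately show "p \<in> {(K, k) \<in> embeddings G.
          snd k ` verts K = emb_verts c \<and> fst k ` bdy K = emb_bdy c}"
        using Emb_member[OF c, of K k] by (simp add: embeddings_def)
    next
      fix p assume "p \<in> {(K, k) \<in> embeddings G.
          snd k ` verts K = emb_verts c \<and> fst k ` bdy K = emb_bdy c}"
      then have "((H, f), p) \<in> emb_equiv G"
        using H by (cases p) (simp add: embeddings_equiv_iff)
      then show "p \<in> c"
        using H(2) by blast
    qed
  qed
  show ?thesis
    using *[OF c] *[OF d] eq by simp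
qed

lemma Emb_of_shape:
  assumes "connected_ext G" and "emb_shape G W B"
  shows "\<exists>c\<in>Emb G. emb_verts c = W \<and> emb_bdy c = B"
proof -
  obtain H f where H: "(H, f) \<in> embeddings G" "snd f ` verts H = W" "fst f ` bdy H = B"
    using embedding_of_shape[OF assms] by auto
  then have "emb_equiv G `` {(H, f)} \<in> Emb G"
    unfolding Emb_def by (intro quotientI)
  then show ?thesis
    using H emb_verts_class emb_bdy_class by metis
qed

text \<open>All representatives of a class share one shape, so whether a factorization exists does
  not depend on their choice.\<close>

lemma emb_le_iff:
  assumes c: "c \<in> Emb G" and d: "d \<in> Emb G"
  shows "emb_le c d \<longleftrightarrow> shape_le G (emb_verts c) (emb_bdy c) (emb_verts d) (emb_bdy d)"
proof -
  have key: "(\<exists>j. embedding H K j \<and> agree H h (gmap_comp k j)) \<longleftrightarrow>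
      shape_le G (emb_verts c) (emb_bdy c) (emb_verts d) (emb_bdy d)"
    if "(H, h) \<in> c" "(K, k) \<in> d" for H h K k
    using embedding_factors_iff Emb_member[OF c that(1)] Emb_member[OF d that(2)] by metis
  obtain H h where H: "(H, h) \<in> c" using Emb_memE[OF c] by metis
  obtain K k where K: "(K, k) \<in> d" using Emb_memE[OF d] by metis
  show ?thesis
  proof
    assume "emb_le c d"
    then show "shape_le G (emb_verts c) (emb_bdy c) (emb_verts d) (emb_bdy d)"
      unfolding emb_le_def using key by blast
  next
    assume "shape_le G (emb_verts c) (emb_bdy c) (emb_verts d) (emb_bdy d)"
    then show "emb_le c d"
      unfolding emb_le_def using key[OF H K] H K by blast
  qed
qed

text \<open>The non-empty boundary excludes the nodeless loop, the only other connected graph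
  without vertices.\<close>

lemma isomorphic_edge_graph_iff:
  assumes H: "connected_ext H"
  shows "isomorphic H edge_graph \<longleftrightarrow> verts H = {} \<and> bdy H \<noteq> {}"
proof
  assume "isomorphic H edge_graph"
  then show "verts H = {} \<and> bdy H \<noteq> {}"
    by (auto simp: isomorphic_def graph_iso_def bij_betw_def)
next
  assume "verts H = {} \<and> bdy H \<noteq> {}"
  then obtain a where a: "arcs H = {a, dag H a}" "a \<in> arcs H" "darcs H = {}" "bdy H = arcs H"
    "verts H = {}"
    using vertexless[OF H] by metis
  have "dag H a \<noteq> a" "dag H (dag H a) = a"
    using connected_extD[OF H] a(2) by auto
  then have "graph_iso H edge_graph (\<lambda>x. if x = a then 0 else 1, undefined)"
    unfolding graph_iso_def etale_def using a(1,3,4,5) by (auto simp: bij_betw_def)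
  then show "isomorphic H edge_graph"
    by (auto simp: isomorphic_def)
qed

lemma is_edge_iff:
  assumes c: "c \<in> Emb G"
  shows "is_edge c \<longleftrightarrow> emb_verts c = {} \<and> emb_bdy c \<noteq> {}"
proof -
  have key: "isomorphic H edge_graph \<longleftrightarrow> emb_verts c = {} \<and> emb_bdy c \<noteq> {}" if "(H, f) \<in> c" for H f
    using Emb_member[OF c that] isomorphic_edge_graph_iff[OF embeddingD(1)]
    by (metis image_is_empty)
  obtain H f where H: "(H, f) \<in> c" using Emb_memE[OF c] by metis
  show ?thesis
  proof
    assume "is_edge c"
    then show "emb_verts c = {} \<and> emb_bdy c \<noteq> {}"
      unfolding is_edge_def using key by blast
  next
    assume "emb_verts c = {} \<and> emb_bdy c \<noteq> {}"
    then show "is_edge c"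
      unfolding is_edge_def using key[OF H] H by blast
  qed
qed

section \<open>Gluing shapes\<close>

lemma arcs_at_singleton [simp]: "arcs_at G {v} = nb G v"
  by (auto simp: arcs_at_def nb_def)

lemma inner_star [simp]: "inner G {v} (dag G ` nb G v) = {}"
  by (auto simp: inner_def)

lemma arcs_at_subset:
  assumes "connected_ext G"
  shows "arcs_at G W \<subseteq> arcs G"
  using connected_extD(4)[OF assms] by (auto simp: arcs_at_def)

lemma mem_dag_image_arcs_at:
  assumes G: "connected_ext G" and "x \<in> dag G ` arcs_at G W"
  shows "x \<in> arcs G" "dag G x \<in> arcs_at G W"
proof -
  obtain y where y: "y \<in> arcs_at G W" "x = dag G y"
    using assms(2) by auto
  then have "y \<in> arcs G"
    using arcs_at_subset[OF G] by blast
  then show "x \<in> arcs G" "dag G x \<in> arcs_at G W"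
    using y connected_extD(5,7)[OF G] by auto
qed

lemma emb_shape_subset:
  assumes G: "connected_ext G" and "emb_shape G W B"
  shows "W \<subseteq> verts G" "B \<subseteq> arcs G"
proof -
  show "W \<subseteq> verts G"
    using assms(2) by (auto simp: emb_shape_def split: if_splits)
  have "dag G ` arcs_at G W \<subseteq> arcs G"
    using mem_dag_image_arcs_at(1)[OF G] by blast
  moreover have "B = {} \<or> (\<exists>a\<in>arcs G. B = {a, dag G a}) \<or> B \<subseteq> dag G ` arcs_at G W"
    using assms(2) unfolding emb_shape_def by meson
  ultimately show "B \<subseteq> arcs G"
    using connected_extD(5)[OF G] by blast
qed

lemma emb_shape_properD:
  assumes "emb_shape G W B" and "W \<noteq> {}"
  shows "W \<subseteq> verts G" "B \<subseteq> dag G ` arcs_at G W"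
    and "d \<in> inner G W B \<Longrightarrow> dag G d \<in> inner G W B"
    and "W' \<subset> W \<Longrightarrow> W' \<noteq> {} \<Longrightarrow> \<exists>d\<in>inner G W B. tgt G d \<in> W' \<and> tgt G (dag G d) \<notin> W'"
  using assms by (auto simp: emb_shape_def)

lemma emb_shape_empty_iff:
  "emb_shape G {} B \<longleftrightarrow> B = {} \<and> nodeless_loop G \<or> (\<exists>a\<in>arcs G. B = {a, dag G a})"
  by (simp add: emb_shape_def)

lemma emb_shape_edgeD:
  assumes G: "connected_ext G" and "emb_shape G {} B" and "x \<in> B"
  shows "B = {x, dag G x}" "x \<in> arcs G"
  using assms(2,3) connected_extD(5,7)[OF G] by (auto simp: emb_shape_empty_iff)

lemma emb_shape_edge: "a \<in> arcs G \<Longrightarrow> emb_shape G {} {a, dag G a}"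
  by (auto simp: emb_shape_empty_iff)

text \<open>Every edge at \<open>v\<close>, loops included, is cut, so no arc is inner; and a
  singleton has no proper non-empty subset to separate.\<close>

lemma emb_shape_star: "v \<in> verts G \<Longrightarrow> emb_shape G {v} (dag G ` nb G v)"
  by (auto simp: emb_shape_def)

text \<open>Lets the boundary be forgotten once \<open>W\<close> and the inner arcs are known, which
  is how the induction on gluings recognizes its end.\<close>

lemma emb_shape_bdy_eq:
  assumes G: "connected_ext G" and sh: "emb_shape G W B" and ne: "W \<noteq> {}"
  shows "B = dag G ` (arcs_at G W - inner G W B)"
  using emb_shape_properD(2)[OF sh ne] by (auto simp: inner_def)

lemma shape_le_properI:
  assumes "W \<noteq> {}" "W \<subseteq> W'" "inner G W B \<subseteq> inner G W' B'"
  shows "shape_le G W B W' B'"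
  using assms by (auto simp: shape_le_def support_def arcs_at_def)

text \<open>If \<open>W \<noteq> {}\<close>, the partner of a boundary arc has its target in
  \<open>W\<close>, so the whole edge lies in the support.\<close>

lemma edge_shape_le:
  assumes G: "connected_ext G" and sh: "emb_shape G W B" and x: "x \<in> B"
  shows "shape_le G {} {x, dag G x} W B" "shape_le G {} {dag G x, x} W B"
proof -
  have "{x, dag G x} \<subseteq> support G W B"
  proof (cases "W = {}")
    case True
    then show ?thesis
      using emb_shape_edgeD[OF G _ x] sh x by (auto simp: support_def)
  next
    case False
    then have *: "x \<in> dag G ` arcs_at G W"
      using emb_shape_properD(2)[OF sh] x by auto
    then show ?thesis
      using mem_dag_image_arcs_at[OF G *] False by (auto simp: support_def)
  qed
  then show "shape_le G {} {x, dag G x} W B"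
    by (auto simp: shape_le_def support_def inner_def arcs_at_def)
  then show "shape_le G {} {dag G x, x} W B"
    by (simp add: insert_commute)
qed

lemma inner_glue_self:
  assumes G: "connected_ext G" and sh: "emb_shape G W B" and ne: "W \<noteq> {}"
    and x: "x \<in> B" "dag G x \<in> B"
  shows "inner G W (B - {x, dag G x}) = inner G W B \<union> {x, dag G x}"
proof -
  note * = mem_dag_image_arcs_at[OF G]
  have "x \<in> dag G ` arcs_at G W" "dag G x \<in> dag G ` arcs_at G W"
    using emb_shape_properD(2)[OF sh ne] x by auto
  then have "x \<in> arcs G" "dag G x \<in> arcs_at G W" "x \<in> arcs_at G W"
    using *[of x] *[of "dag G x"] connected_extD(7)[OF G] by auto
  moreover have "dag G d = x \<longleftrightarrow> d = dag G x" "dag G d = dag G x \<longleftrightarrow> d = x"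
    if "d \<in> arcs_at G W" for d
    using that arcs_at_subset[OF G] connected_extD(5,7)[OF G] \<open>x \<in> arcs G\<close> by (metis subsetD)+
  ultimately show ?thesis
    unfolding inner_def by blast
qed

text \<open>For \<open>W \<noteq> {}\<close> the gluing keeps the vertices and only adds inner arcs,
  so connectivity survives. Gluing the two ends of an edge leaves neither vertices nor boundary,
  which is a shape only in a nodeless loop; hence \<open>nl\<close>.\<close>

lemma emb_shape_glue_self:
  assumes G: "connected_ext G" and sh: "emb_shape G W B" and x: "x \<in> B" "dag G x \<in> B"
    and nl: "W = {} \<Longrightarrow> nodeless_loop G"
  shows "emb_shape G W (B - {x, dag G x})" "shape_le G W B W (B - {x, dag G x})"
proof -
  have "emb_shape G W (B - {x, dag G x}) \<and> shape_le G W B W (B - {x, dag G x})"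
  proof (cases "W = {}")
    case True
    then have B: "B = {x, dag G x}" "x \<in> arcs G"
      using emb_shape_edgeD[OF G _ x(1)] sh by auto
    then have "emb_shape G W (B - {x, dag G x})"
      using True nl by (simp add: emb_shape_empty_iff)
    then show ?thesis
      using True B connected_extD(5)[OF G B(2)]
      by (auto simp: shape_le_def inner_def arcs_at_def support_def)
  next
    case False
    note inn = inner_glue_self[OF G sh False x]
    note sh' = emb_shape_properD[OF sh False]
    have "dag G (dag G x) = x"
      using emb_shape_subset(2)[OF G sh] x connected_extD(7)[OF G] by auto
    then have "emb_shape G W (B - {x, dag G x})"
      unfolding emb_shape_def inn using False sh' by (auto 0 3)
    moreover have "shape_le G W B W (B - {x, dag G x})"
      by (rule shape_le_properI) (use False inn in auto)
    ultimately show ?thesis by blast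
  qed
  then show "emb_shape G W (B - {x, dag G x})" "shape_le G W B W (B - {x, dag G x})"
    by auto
qed

text \<open>Each boundary lies opposite the arcs of its own piece, and disjoint vertex sets have
  disjoint sets of arcs. So neither boundary cuts an edge at the other piece's arcs, and just the
  edge of \<open>x\<close> becomes inner.\<close>

lemma inner_glue:
  assumes G: "connected_ext G" and sh1: "emb_shape G W1 B1" and sh2: "emb_shape G W2 B2"
    and ne: "W1 \<noteq> {}" "W2 \<noteq> {}" and dis: "W1 \<inter> W2 = {}" and x: "x \<in> B1" "dag G x \<in> B2"
  shows "inner G (W1 \<union> W2) (B1 - {x} \<union> (B2 - {dag G x})) =
      inner G W1 B1 \<union> inner G W2 B2 \<union> {x, dag G x}" (is "?inn = _")
    and "x \<in> arcs_at G W2" "dag G x \<in> arcs_at G W1"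
proof -
  note * = mem_dag_image_arcs_at[OF G]
  note B1 = emb_shape_properD(2)[OF sh1 ne(1)] and B2 = emb_shape_properD(2)[OF sh2 ne(2)]
  have "x \<in> dag G ` arcs_at G W1" "dag G x \<in> dag G ` arcs_at G W2"
    using B1 B2 x by auto
  then show x': "x \<in> arcs_at G W2" "dag G x \<in> arcs_at G W1"
    using *[of x] *[of "dag G x"] connected_extD(7)[OF G] by auto
  have xG: "x \<in> arcs G"
    using x'(1) arcs_at_subset[OF G, of W2] by blast
  have U: "arcs_at G (W1 \<union> W2) = arcs_at G W1 \<union> arcs_at G W2"
    and D: "arcs_at G W1 \<inter> arcs_at G W2 = {}"
    using dis by (auto simp: arcs_at_def)
  have inj: "dag G d = x \<longleftrightarrow> d = dag G x" "dag G d = dag G x \<longleftrightarrow> d = x"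
    if "d \<in> arcs_at G W1 \<union> arcs_at G W2" for d
    using that arcs_at_subset[OF G] connected_extD(5,7)[OF G] xG by (metis Un_iff subsetD)+
  have n: "dag G d \<notin> B2" if "d \<in> arcs_at G W1" for d
  proof
    assume "dag G d \<in> B2"
    then have "dag G (dag G d) \<in> arcs_at G W2"
      using B2 *(2) by blast
    moreover have "d \<in> arcs G"
      using that arcs_at_subset[OF G] by blast
    ultimately show False
      using D that connected_extD(7)[OF G] by auto
  qed
  have m: "dag G d \<notin> B1" if "d \<in> arcs_at G W2" for d
  proof
    assume "dag G d \<in> B1"
    then have "dag G (dag G d) \<in> arcs_at G W1"
      using B1 *(2) by blast
    moreover have "d \<in> arcs G"
      using that arcs_at_subset[OF G] by blast
    ultimately show False
      using D that connected_extD(7)[OF G] by auto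
  qed
  have "d \<in> ?inn \<longleftrightarrow> d \<in> inner G W1 B1 \<union> inner G W2 B2 \<union> {x, dag G x}" for d
  proof -
    consider "d \<in> arcs_at G W1" "d \<notin> arcs_at G W2" | "d \<in> arcs_at G W2" "d \<notin> arcs_at G W1"
      | "d \<notin> arcs_at G W1 \<union> arcs_at G W2"
      using D by blast
    then show ?thesis
    proof cases
      case 1
      then show ?thesis
        using n[OF 1(1)] inj[of d] x' by (auto simp: inner_def U)
    next
      case 2
      then show ?thesis
        using m[OF 2(1)] inj[of d] x' by (auto simp: inner_def U)
    next
      case 3
      then show ?thesis
        using x' by (auto simp: inner_def U)
    qed
  qed
  then show "?inn = inner G W1 B1 \<union> inner G W2 B2 \<union> {x, dag G x}"
    by blast
qed

text \<open>If one piece is an edge, the result is the other piece. Otherwise a proper subset of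
  \<open>W\<close> either splits a piece, and an old inner arc leaves it, or is one of the pieces,
  and the new inner edge leaves it.\<close>

lemma emb_shape_glue_aux:
  assumes G: "connected_ext G" and sh1: "emb_shape G W1 B1" and sh2: "emb_shape G W2 B2"
    and dis: "W1 \<inter> W2 = {}" and x: "x \<in> B1" "dag G x \<in> B2"
  defines "W \<equiv> W1 \<union> W2" and "B \<equiv> B1 - {x} \<union> (B2 - {dag G x})"
  shows "emb_shape G W B \<and> shape_le G W1 B1 W B \<and> (B1 - {x}) \<inter> (B2 - {dag G x}) = {}"
proof -
  have xG: "x \<in> arcs G"
    using emb_shape_subset(2)[OF G sh1] x by auto
  note dx = connected_extD(6,7)[OF G xG]
  consider "W1 = {}" | "W1 \<noteq> {}" "W2 = {}" | "W1 \<noteq> {}" "W2 \<noteq> {}" by blast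
  then show ?thesis
  proof cases
    case 1
    then have B1: "B1 = {x, dag G x}"
      using emb_shape_edgeD[OF G _ x(1)] sh1 by auto
    then have "B = B2" "W = W2"
      using x dx 1 by (auto simp: B_def W_def)
    then show ?thesis
      using sh2 edge_shape_le(2)[OF G sh2 x(2)] B1 1 dx by auto
  next
    case 2
    then have B2: "B2 = {x, dag G x}"
      using emb_shape_edgeD[OF G _ x(2)] sh2 dx by auto
    then have "B = B1" "W = W1"
      using x dx 2 by (auto simp: B_def W_def)
    then show ?thesis
      using sh1 shape_le_refl B2 by auto
  next
    case 3
    note inn = inner_glue[OF G sh1 sh2 3 dis x, folded W_def B_def]
    note s1 = emb_shape_properD[OF sh1 3(1)] and s2 = emb_shape_properD[OF sh2 3(2)]
    have U: "arcs_at G W = arcs_at G W1 \<union> arcs_at G W2"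
      and D: "arcs_at G W1 \<inter> arcs_at G W2 = {}"
      using dis by (auto simp: W_def arcs_at_def)
    have "(B1 - {x}) \<inter> (B2 - {dag G x}) = {}"
      using s1(2) s2(2) D mem_dag_image_arcs_at(2)[OF G] by blast
    moreover have "shape_le G W1 B1 W B"
      by (rule shape_le_properI) (use 3 inn in \<open>auto simp: W_def\<close>)
    moreover have "emb_shape G W B"
    proof -
      have "W \<subseteq> verts G" "B \<subseteq> dag G ` arcs_at G W"
        using s1(1,2) s2(1,2) U by (auto simp: W_def B_def)
      moreover have "\<forall>d\<in>inner G W B. dag G d \<in> inner G W B"
        using inn(1) s1(3) s2(3) dx by auto
      moreover have "\<exists>d\<in>inner G W B. tgt G d \<in> W' \<and> tgt G (dag G d) \<notin> W'"
        if W': "W' \<subset> W" "W' \<noteq> {}" for W'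
      proof -
        consider "W' \<inter> W1 \<subset> W1" "W' \<inter> W1 \<noteq> {}" | "W' \<inter> W2 \<subset> W2" "W' \<inter> W2 \<noteq> {}"
          | "W' = W1" | "W' = W2"
          using W' dis unfolding W_def by blast
        then show ?thesis
        proof cases
          case 1
          then obtain d where d: "d \<in> inner G W1 B1" "tgt G d \<in> W'" "tgt G (dag G d) \<notin> W' \<inter> W1"
            using s1(4)[of "W' \<inter> W1"] by auto
          then have "tgt G (dag G d) \<in> W1"
            using s1(3)[OF d(1)] by (auto simp: inner_def arcs_at_def)
          then show ?thesis
            using d inn(1) by blast
        next
          case 2
          then obtain d where d: "d \<in> inner G W2 B2" "tgt G d \<in> W'" "tgt G (dag G d) \<notin> W' \<inter> W2"
            using s2(4)[of "W' \<inter> W2"] by auto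
          then have "tgt G (dag G d) \<in> W2"
            using s2(3)[OF d(1)] by (auto simp: inner_def arcs_at_def)
          then show ?thesis
            using d inn(1) by blast
        next
          case 3
          then have "tgt G (dag G x) \<in> W'" "tgt G (dag G (dag G x)) \<notin> W'"
            using inn(2,3) dis dx by (auto simp: arcs_at_def)
          then show ?thesis
            using inn(1) by blast
        next
          case 4
          then have "tgt G x \<in> W'" "tgt G (dag G x) \<notin> W'"
            using inn(2,3) dis by (auto simp: arcs_at_def)
          then show ?thesis
            using inn(1) by blast
        qed
      qed
      ultimately show ?thesis
        using 3 unfolding emb_shape_def by (simp add: W_def)
    qed
    ultimately show ?thesis by blast
  qed
qed

lemma emb_shape_glue:
  assumes G: "connected_ext G" and sh1: "emb_shape G W1 B1" and sh2: "emb_shape G W2 B2"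
    and dis: "W1 \<inter> W2 = {}" and x: "x \<in> B1" "dag G x \<in> B2"
  defines "W \<equiv> W1 \<union> W2" and "B \<equiv> B1 - {x} \<union> (B2 - {dag G x})"
  shows "emb_shape G W B" "shape_le G W1 B1 W B" "shape_le G W2 B2 W B"
    and "(B1 - {x}) \<inter> (B2 - {dag G x}) = {}"
proof -
  have dx: "dag G (dag G x) = x"
    using emb_shape_subset(2)[OF G sh1] x connected_extD(7)[OF G] by auto
  show "emb_shape G W B" "shape_le G W1 B1 W B" "(B1 - {x}) \<inter> (B2 - {dag G x}) = {}"
    unfolding W_def B_def using emb_shape_glue_aux[OF G sh1 sh2 dis x] by auto
  \<comment> \<open>Exchanging the pieces together with \<open>x\<close> and \<open>dag G x\<close>
    leaves the result unchanged.\<close>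
  show "shape_le G W2 B2 W B"
    unfolding W_def B_def
    using emb_shape_glue_aux[OF G sh2 sh1, of "dag G x"] dis x dx by (simp add: Un_commute Int_commute)
qed

text \<open>Nothing is cut, so every arc at \<open>W\<close> has its partner at \<open>W\<close>,
  and the pair is saturated. A closed class thus involves all vertices of \<open>G\<close>, as
  condition (c') requires.\<close>

lemma emb_shape_closed:
  assumes G: "connected_ext G" and sh: "emb_shape G W {}" and ne: "W \<noteq> {}"
  shows "W = verts G" "bdy G = {}"
proof -
  note sh = emb_shape_properD[OF sh ne]
  have "arcs_at G W = {} \<and> W = {} \<or> arcs_at G W = arcs G \<and> W = verts G"
  proof (rule connected_saturated[OF G arcs_at_subset[OF G] sh(1)])
    show "dag G a \<in> arcs_at G W" if "a \<in> arcs_at G W" for a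
      using sh(3)[of a] that by (auto simp: inner_def)
  qed (auto simp: arcs_at_def)
  then have *: "arcs_at G W = arcs G" "W = verts G"
    using ne by auto
  then show "W = verts G" by simp
  have "arcs G \<subseteq> darcs G"
    using * by (auto simp: arcs_at_def)
  then show "bdy G = {}"
    using connected_extD(11)[OF G] ne * by auto
qed

text \<open>
  Each step turns one more edge of \<open>(W, B)\<close> into an inner edge; its second end either lies in
  \<open>U\<close> already or contributes its star.
\<close>

lemma proper_shape_induct:
  assumes G: "connected_ext G" and sh: "emb_shape G W B"
    and init: "emb_shape G W0 B0" "W0 \<noteq> {}" "shape_le G W0 B0 W B" "P W0 B0"
    and self: "\<And>U C x. \<lbrakk>emb_shape G U C; U \<noteq> {}; P U C; x \<in> C; dag G x \<in> C\<rbrakk>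
        \<Longrightarrow> P U (C - {x, dag G x})"
    and star: "\<And>U C v x. \<lbrakk>emb_shape G U C; U \<noteq> {}; P U C; v \<in> verts G; v \<notin> U;
        x \<in> C; dag G x \<in> dag G ` nb G v\<rbrakk>
        \<Longrightarrow> P (U \<union> {v}) (C - {x} \<union> (dag G ` nb G v - {dag G x}))"
  shows "P W B"
  using init
\<comment> \<open>The measure counts the inner arcs still missing; the starting shape is generalized
  because it is the one that grows.\<close>
proof (induction "card (inner G W B - inner G W0 B0)" arbitrary: W0 B0 rule: less_induct)
  case (less U C)
  note G' = connected_extD[OF G]
  have ne: "W \<noteq> {}" and sub: "U \<subseteq> W" and innsub: "inner G U C \<subseteq> inner G W B"
    using less.prems by (auto simp: shape_le_def)
  note shU = emb_shape_properD[OF less.prems(1,2)] and shW = emb_shape_properD[OF sh ne]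
  have fin: "finite (inner G W B)"
    using arcs_at_subset[OF G] G'(1) by (auto simp: inner_def intro: finite_subset)
  show ?case
  proof (cases "inner G W B = inner G U C")
    case True
    \<comment> \<open>By connectivity some inner arc would leave \<open>U\<close>; being inner for
      \<open>U\<close> too, it would have its partner at \<open>U\<close>.\<close>
    have "U = W"
    proof (rule ccontr)
      assume "U \<noteq> W"
      then obtain d where "d \<in> inner G U C" "tgt G (dag G d) \<notin> U"
        using shW(4)[of U] sub less.prems(2) True by auto
      then show False
        using shU(3)[of d] by (auto simp: inner_def arcs_at_def)
    qed
    moreover from this have "C = B"
      using emb_shape_bdy_eq[OF G sh ne] emb_shape_bdy_eq[OF G less.prems(1,2)] True by metis
    ultimately show ?thesis
      using less.prems by simp
  next
    case False
    \<comment> \<open>The next edge to glue must start in \<open>U\<close>. If \<open>U = W\<close>,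
      any missing arc does; otherwise connectivity of \<open>W\<close> provides one leaving
      \<open>U\<close>.\<close>
    have "\<exists>d\<in>inner G W B. d \<notin> inner G U C \<and> tgt G d \<in> U"
    proof (cases "U = W")
      case True
      then show ?thesis
        using False innsub by (auto simp: inner_def arcs_at_def)
    next
      case False
      then obtain d where "d \<in> inner G W B" "tgt G d \<in> U" "tgt G (dag G d) \<notin> U"
        using shW(4)[of U] sub less.prems(2) by auto
      then show ?thesis
        using shU(3)[of d] by (auto simp: inner_def arcs_at_def)
    qed
    then obtain d where d: "d \<in> inner G W B" "d \<notin> inner G U C" "tgt G d \<in> U" by blast
    have dG: "d \<in> arcs G" "d \<in> darcs G" "dag G d \<in> inner G W B"
      using d(1) shW(3) arcs_at_subset[OF G] by (auto simp: inner_def arcs_at_def)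
    have dd: "dag G (dag G d) = d"
      using G'(7) dG by auto
    have dU: "d \<in> arcs_at G U"
      using d dG by (auto simp: arcs_at_def)
    then have dC: "dag G d \<in> C"
      using d(2) by (auto simp: inner_def)
    have step: thesis
      if sh': "emb_shape G U' C'" and sub': "U \<subseteq> U'" "U' \<subseteq> W" and P': "P U' C'"
        and inn': "inner G U' C' = inner G U C \<union> {d, dag G d}"
        and 1: "P W B \<Longrightarrow> thesis" for U' C' thesis
    proof (rule 1, rule less.hyps[OF _ sh' _ _ P'])
      show "card (inner G W B - inner G U' C') < card (inner G W B - inner G U C)"
        using fin d inn' by (intro psubset_card_mono) auto
      show "U' \<noteq> {}"
        using sub' less.prems(2) by auto
      then show "shape_le G U' C' W B"
        using sub' inn' innsub d(1) dG by (intro shape_le_properI) auto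
    qed
    show ?thesis
    proof (cases "tgt G (dag G d) \<in> U")
      case True
      then have "dag G d \<in> arcs_at G U"
        using dG by (auto simp: inner_def arcs_at_def)
      moreover have "dag G d \<notin> inner G U C"
        using shU(3)[of "dag G d"] dd d(2) by auto
      ultimately have "d \<in> C"
        using dd by (auto simp: inner_def)
      show ?thesis
      proof (rule step[of U "C - {d, dag G d}"])
        show "emb_shape G U (C - {d, dag G d})"
          using emb_shape_glue_self(1)[OF G less.prems(1) \<open>d \<in> C\<close> dC] less.prems(2) by blast
        show "P U (C - {d, dag G d})"
          using self less.prems dC \<open>d \<in> C\<close> by blast
        show "inner G U (C - {d, dag G d}) = inner G U C \<union> {d, dag G d}"
          using inner_glue_self[OF G less.prems(1,2) \<open>d \<in> C\<close> dC] .
      qed (use sub in auto)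
    next
      case False
      define v where "v = tgt G (dag G d)"
      have v: "v \<in> verts G" "v \<notin> U" "v \<in> W" "dag G d \<in> nb G v"
        using dG False G'(9) by (auto simp: v_def inner_def arcs_at_def nb_def)
      have dn: "dag G (dag G d) \<in> dag G ` nb G v"
        using v by blast
      let ?C = "C - {dag G d} \<union> (dag G ` nb G v - {dag G (dag G d)})"
      show ?thesis
      proof (rule step[of "U \<union> {v}" ?C])
        show "emb_shape G (U \<union> {v}) ?C"
          using emb_shape_glue(1)[OF G less.prems(1) emb_shape_star[OF v(1)] _ dC dn] v(2) by blast
        show "P (U \<union> {v}) ?C"
          using star[OF less.prems(1,2,4) v(1,2) dC dn] .
        show "inner G (U \<union> {v}) ?C = inner G U C \<union> {d, dag G d}"
          using inner_glue(1)[OF G less.prems(1) emb_shape_star[OF v(1)] less.prems(2) _ _ dC dn] v(2) dd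
          by auto
      qed (use sub v in auto)
    qed
  qed
qed

section \<open>Extending graphical maps to all embeddings\<close>

text \<open>The conjuncts are ordered as in \<open>graphical_comp\<close>, so that the classes
  chosen there become values of this function by unfolding.\<close>

definition shape_class :: "('a, 'v) ugraph \<Rightarrow> 'v set \<Rightarrow> 'a set \<Rightarrow> ('a, 'v) emb_class" where
  "shape_class G W B = (THE c. c \<in> Emb G \<and> emb_bdy c = B \<and> emb_verts c = W)"

lemma shape_class:
  assumes "connected_ext G" and "emb_shape G W B"
  shows "shape_class G W B \<in> Emb G" "emb_verts (shape_class G W B) = W"
    "emb_bdy (shape_class G W B) = B"
proof -
  have "\<exists>!c. c \<in> Emb G \<and> emb_bdy c = B \<and> emb_verts c = W"
    using Emb_of_shape[OF assms] Emb_eqI by metis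
  from theI'[OF this] show "shape_class G W B \<in> Emb G" "emb_verts (shape_class G W B) = W"
    "emb_bdy (shape_class G W B) = B"
    by (auto simp: shape_class_def)
qed

lemma shape_class_eqI:
  assumes G: "connected_ext G" and c: "c \<in> Emb G" "emb_verts c = W" "emb_bdy c = B"
  shows "shape_class G W B = c"
  using Emb_shape[OF c(1)] c shape_class[OF G, of W B] Emb_eqI by metis

lemma finite_emb_bdy: "connected_ext G \<Longrightarrow> c \<in> Emb G \<Longrightarrow> finite (emb_bdy c)"
  using emb_shape_subset(2)[OF _ Emb_shape] connected_extD(1) finite_subset by metis

definition extend_graphical ::
    "('a, 'v) ugraph \<Rightarrow> ('b, 'w) ugraph \<Rightarrow> ('a, 'v, 'b, 'w) graphical \<Rightarrow>
     ('a, 'v, 'b, 'w) new_map" where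
  "extend_graphical G G' p =
     (fst p, \<lambda>h\<in>Emb G. shape_class G' (\<Union>v\<in>emb_verts h. emb_verts (snd p v)) (fst p ` emb_bdy h))"

abbreviation star_class :: "('a, 'v) ugraph \<Rightarrow> 'v \<Rightarrow> ('a, 'v) emb_class" where
  "star_class G v \<equiv> shape_class G {v} (dag G ` nb G v)"

definition restrict_new ::
    "('a, 'v) ugraph \<Rightarrow> ('a, 'v, 'b, 'w) new_map \<Rightarrow> ('a, 'v, 'b, 'w) graphical" where
  "restrict_new G p = (fst p, \<lambda>v\<in>verts G. snd p (star_class G v))"

text \<open>The multiplicity of \<open>x\<close> in the sum is the number of \<open>v\<close> with
  \<open>x \<in> A v\<close>, and the bound by a repetition-free multiset makes it at most
  one.\<close>

lemma sum_mset_set_subseteq_iff: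
  assumes "finite V" and "finite X" and "\<And>v. v \<in> V \<Longrightarrow> A v \<subseteq> X"
  shows "(\<Sum>v\<in>V. mset_set (A v)) \<subseteq># mset_set X \<longleftrightarrow> (\<forall>v\<in>V. \<forall>w\<in>V. v \<noteq> w \<longrightarrow> A v \<inter> A w = {})"
proof -
  have fin: "finite (A v)" if "v \<in> V" for v
    using assms that finite_subset by blast
  have count: "count (\<Sum>v\<in>V. mset_set (A v)) x = card {v \<in> V. x \<in> A v}" for x
  proof -
    have "count (\<Sum>v\<in>V. mset_set (A v)) x = (\<Sum>v\<in>V. if x \<in> A v then 1 else 0)"
      unfolding count_sum using fin by (intro sum.cong) (auto simp: count_mset_set')
    also have "\<dots> = card {v \<in> V. x \<in> A v}"
      using assms(1) by (simp add: sum.If_cases Int_def)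
    finally show ?thesis .
  qed
  have "(\<Sum>v\<in>V. mset_set (A v)) \<subseteq># mset_set X \<longleftrightarrow> (\<forall>x. card {v \<in> V. x \<in> A v} \<le> (if x \<in> X then 1 else 0))"
    unfolding subseteq_mset_def count using assms(2) by (simp add: count_mset_set')
  also have "\<dots> \<longleftrightarrow> (\<forall>x. card {v \<in> V. x \<in> A v} \<le> 1)"
  proof -
    have "card {v \<in> V. x \<in> A v} = 0" if "x \<notin> X" for x
      using that assms(3) by (auto simp: card_eq_0_iff)
    then show ?thesis
      by (smt (verit) zero_le)
  qed
  also have "\<dots> \<longleftrightarrow> (\<forall>x. \<forall>v\<in>V. \<forall>w\<in>V. x \<in> A v \<longrightarrow> x \<in> A w \<longrightarrow> v = w)"
    using assms(1) by (simp add: card_le_Suc0_iff_eq) blast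
  also have "\<dots> \<longleftrightarrow> (\<forall>v\<in>V. \<forall>w\<in>V. v \<noteq> w \<longrightarrow> A v \<inter> A w = {})"
    by blast
  finally show ?thesis .
qed

text \<open>The multiset and bijection conditions become statements on sets. Edges may be replaced
  by vertexless classes in (c'): the two differ only if \<open>G'\<close> is a nodeless loop, and
  then the condition holds anyway.\<close>

lemma graphical_maps_Ut_iff:
  assumes G: "connected_ext G" and G': "connected_ext G'"
  shows "(p0, p1) \<in> graphical_maps_Ut G G' \<longleftrightarrow>
    p0 \<in> involutive_funs G G' \<and> p1 \<in> verts G \<rightarrow>\<^sub>E Emb G' \<and>
    (\<forall>v\<in>verts G. \<forall>w\<in>verts G. v \<noteq> w \<longrightarrow> emb_verts (p1 v) \<inter> emb_verts (p1 w) = {}) \<and>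
    (\<forall>v\<in>verts G. inj_on p0 (dag G ` nb G v) \<and> emb_bdy (p1 v) = p0 ` dag G ` nb G v) \<and>
    (bdy G = {} \<and> (\<forall>v\<in>verts G. emb_verts (p1 v) = {}) \<longrightarrow> nodeless_loop G')"
proof (cases "p0 \<in> involutive_funs G G' \<and> p1 \<in> verts G \<rightarrow>\<^sub>E Emb G'")
  case True
  then have p1: "p1 v \<in> Emb G'" if "v \<in> verts G" for v
    using that by auto
  have sum: "(\<Sum>v\<in>verts G. mset_set (emb_verts (p1 v))) \<subseteq># mset_set (verts G') \<longleftrightarrow>
      (\<forall>v\<in>verts G. \<forall>w\<in>verts G. v \<noteq> w \<longrightarrow> emb_verts (p1 v) \<inter> emb_verts (p1 w) = {})"
    by (rule sum_mset_set_subseteq_iff)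
      (use connected_extD(2)[OF G] connected_extD(2)[OF G'] emb_shape_subset(1)[OF G' Emb_shape[OF p1]]
       in auto)
  have bij: "bij_betw (\<lambda>a. p0 (dag G a)) (nb G v) (emb_bdy (p1 v)) \<longleftrightarrow>
      inj_on p0 (dag G ` nb G v) \<and> emb_bdy (p1 v) = p0 ` dag G ` nb G v" for v
  proof -
    have "inj_on (dag G) (nb G v)"
      using connected_extD(7)[OF G] arcs_at_subset[OF G, of "{v}"]
      by (intro inj_on_inverseI[of _ "dag G"]) auto
    then show ?thesis
      unfolding bij_betw_def using comp_inj_on_iff[of "dag G" "nb G v" p0]
      by (auto simp: image_image o_def)
  qed
  have loop: "(\<forall>v\<in>verts G. is_edge (p1 v)) \<longleftrightarrow> (\<forall>v\<in>verts G. emb_verts (p1 v) = {})"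
    if "\<not> nodeless_loop G'"
  proof -
    have "emb_bdy (p1 v) \<noteq> {}" if "v \<in> verts G" "emb_verts (p1 v) = {}" for v
      using Emb_shape[OF p1[OF that(1)]] that(2) \<open>\<not> nodeless_loop G'\<close>
      by (auto simp: emb_shape_empty_iff)
    then show ?thesis
      using is_edge_iff[OF p1] by blast
  qed
  show ?thesis
    unfolding graphical_maps_Ut_def pre_graphical_maps_def
    using True sum bij loop by auto
qed (auto simp: graphical_maps_Ut_def pre_graphical_maps_def)

text \<open>When the codomain is not a nodeless loop, (c') is the contrapositive of (c).\<close>

lemma graphical_maps_U_eq:
  assumes "connected_ordinary G'"
  shows "graphical_maps_U G G' = graphical_maps_Ut G G'"
  using assms ordinary_not_loop[of G']
  by (auto simp: graphical_maps_U_def graphical_maps_Ut_def connected_ordinary_def)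

section \<open>Images of shapes under a graphical map\<close>

locale graphical_map =
  fixes G :: "('a, 'v) ugraph" and G' :: "('b, 'w) ugraph" and p0 p1
  assumes G: "connected_ext G" and G': "connected_ext G'"
    and mem: "(p0, p1) \<in> graphical_maps_Ut G G'"
begin

lemmas mem_iff = mem[unfolded graphical_maps_Ut_iff[OF G G']]

lemma p0: "a \<in> arcs G \<Longrightarrow> p0 a \<in> arcs G'" "a \<in> arcs G \<Longrightarrow> p0 (dag G a) = dag G' (p0 a)"
  using mem_iff by (auto simp: involutive_funs_def)

lemma p1: "v \<in> verts G \<Longrightarrow> p1 v \<in> Emb G'"
  and p1_disjoint: "\<lbrakk>v \<in> verts G; w \<in> verts G; v \<noteq> w\<rbrakk> \<Longrightarrow> emb_verts (p1 v) \<inter> emb_verts (p1 w) = {}"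
  and p0_inj_nb: "v \<in> verts G \<Longrightarrow> inj_on p0 (dag G ` nb G v)"
  and p1_bdy: "v \<in> verts G \<Longrightarrow> emb_bdy (p1 v) = p0 ` dag G ` nb G v"
  and p1_loop: "\<lbrakk>bdy G = {}; \<And>v. v \<in> verts G \<Longrightarrow> emb_verts (p1 v) = {}\<rbrakk> \<Longrightarrow> nodeless_loop G'"
  using mem_iff by auto

definition V :: "'v set \<Rightarrow> 'w set" where
  "V W = (\<Union>v\<in>W. emb_verts (p1 v))"

lemma star_image_shape: "v \<in> verts G \<Longrightarrow> emb_shape G' (V {v}) (p0 ` dag G ` nb G v)"
  using Emb_shape[OF p1] p1_bdy by (auto simp: V_def)

text \<open>The start is arbitrary because the result serves twice: from a star it shows that images
  are shapes, and from a smaller proper shape it gives monotonicity. Injectivity belongs to the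
  invariant so that removing glued arcs commutes with taking images.\<close>

lemma proper_image:
  assumes sh: "emb_shape G W B" and init: "emb_shape G W0 B0" "W0 \<noteq> {}" "shape_le G W0 B0 W B"
    and im: "inj_on p0 B0" "emb_shape G' (V W0) (p0 ` B0)"
  shows "inj_on p0 B \<and> emb_shape G' (V W) (p0 ` B) \<and> shape_le G' (V W0) (p0 ` B0) (V W) (p0 ` B)"
  using sh init
proof (rule proper_shape_induct[OF G])
  show "inj_on p0 B0 \<and> emb_shape G' (V W0) (p0 ` B0) \<and> shape_le G' (V W0) (p0 ` B0) (V W0) (p0 ` B0)"
    using im shape_le_refl by blast
next
  fix U C x
  assume sh: "emb_shape G U C" and ne: "U \<noteq> {}" and x: "x \<in> C" "dag G x \<in> C"
    and "inj_on p0 C \<and> emb_shape G' (V U) (p0 ` C) \<and> shape_le G' (V W0) (p0 ` B0) (V U) (p0 ` C)"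
  then have inj: "inj_on p0 C" and sh': "emb_shape G' (V U) (p0 ` C)"
    and le: "shape_le G' (V W0) (p0 ` B0) (V U) (p0 ` C)" by auto
  have px: "p0 (dag G x) = dag G' (p0 x)"
    using p0 x emb_shape_subset(2)[OF G sh] by blast
  have img: "p0 ` (C - {x, dag G x}) = p0 ` C - {p0 x, dag G' (p0 x)}"
    using inj_on_image_set_diff[OF inj, of C "{x, dag G x}"] x px by auto
  \<comment> \<open>Here \<open>U\<close> is sent to an edge, so the image of \<open>C\<close>
    consists of the two arcs being glued. By injectivity \<open>C\<close> contains no others, the
    glued shape is closed and comprises all of \<open>G\<close>, and (c') applies.\<close>
  have "nodeless_loop G'" if VU: "V U = {}"
  proof -
    have "p0 ` C = {p0 x, dag G' (p0 x)}"
      using emb_shape_edgeD(1)[OF G'] sh' VU x(1) by auto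
    then have "p0 ` (C - {x, dag G x}) = {}"
      using img by simp
    then have "C - {x, dag G x} = {}"
      by simp
    then have "emb_shape G U {}"
      using emb_shape_glue_self(1)[OF G sh x] ne by metis
    then have "U = verts G" "bdy G = {}"
      using emb_shape_closed[OF G _ ne] by auto
    then show ?thesis
      using p1_loop VU by (auto simp: V_def)
  qed
  moreover have "p0 x \<in> p0 ` C" "dag G' (p0 x) \<in> p0 ` C"
    using x imageI[OF x(2), of p0] px by auto
  ultimately have "emb_shape G' (V U) (p0 ` (C - {x, dag G x}))"
    "shape_le G' (V U) (p0 ` C) (V U) (p0 ` (C - {x, dag G x}))"
    using emb_shape_glue_self[OF G' sh'] unfolding img by auto
  then show "inj_on p0 (C - {x, dag G x}) \<and> emb_shape G' (V U) (p0 ` (C - {x, dag G x})) \<and>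
      shape_le G' (V W0) (p0 ` B0) (V U) (p0 ` (C - {x, dag G x}))"
    using inj_on_subset[OF inj] shape_le_trans[OF le] by blast
next
  fix U C v x
  assume sh: "emb_shape G U C" and ne: "U \<noteq> {}" and v: "v \<in> verts G" "v \<notin> U"
    and x: "x \<in> C" "dag G x \<in> dag G ` nb G v"
    and "inj_on p0 C \<and> emb_shape G' (V U) (p0 ` C) \<and> shape_le G' (V W0) (p0 ` B0) (V U) (p0 ` C)"
  then have inj: "inj_on p0 C" and sh': "emb_shape G' (V U) (p0 ` C)"
    and le: "shape_le G' (V W0) (p0 ` B0) (V U) (p0 ` C)" by auto
  let ?B = "dag G ` nb G v"
  let ?C = "C - {x} \<union> (?B - {dag G x})"
  have px: "p0 (dag G x) = dag G' (p0 x)"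
    using p0 x emb_shape_subset(2)[OF G sh] by blast
  have img: "p0 ` (C - {x}) = p0 ` C - {p0 x}" "p0 ` (?B - {dag G x}) = p0 ` ?B - {dag G' (p0 x)}"
    using inj_on_image_set_diff[OF inj, of C "{x}"]
      inj_on_image_set_diff[OF p0_inj_nb[OF v(1)], of ?B "{dag G x}"] x px by auto
  have "V U \<inter> V {v} = {}"
    using p1_disjoint v emb_shape_subset(1)[OF G sh] unfolding V_def by blast
  moreover have "p0 x \<in> p0 ` C" "dag G' (p0 x) \<in> p0 ` ?B"
    using x imageI[OF x(2), of p0] px by auto
  ultimately have glue:
    "emb_shape G' (V U \<union> V {v}) (p0 ` (C - {x}) \<union> p0 ` (?B - {dag G x}))"
    "shape_le G' (V U) (p0 ` C) (V U \<union> V {v}) (p0 ` (C - {x}) \<union> p0 ` (?B - {dag G x}))"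
    "p0 ` (C - {x}) \<inter> p0 ` (?B - {dag G x}) = {}"
    using emb_shape_glue[OF G' sh' star_image_shape[OF v(1)], of "p0 x"] unfolding img by auto
  have "inj_on p0 (C - {x})" "inj_on p0 (?B - {dag G x})"
    by (rule inj_on_subset[OF inj] inj_on_subset[OF p0_inj_nb[OF v(1)]]; blast)+
  \<comment> \<open>Each part is injective, and the two images are disjoint because they are the
    remaining boundaries of the pieces glued in \<open>G'\<close>.\<close>
  then have "inj_on p0 ?C"
    unfolding inj_on_Un using glue(3) by blast
  moreover have "V (U \<union> {v}) = V U \<union> V {v}"
    by (auto simp: V_def)
  ultimately show "inj_on p0 ?C \<and> emb_shape G' (V (U \<union> {v})) (p0 ` ?C) \<and>
      shape_le G' (V W0) (p0 ` B0) (V (U \<union> {v})) (p0 ` ?C)"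
    using glue(1,2) shape_le_trans[OF le] by (simp add: image_Un)
qed

lemma star_le:
  assumes "W \<noteq> {}" and "v \<in> W"
  shows "shape_le G {v} (dag G ` nb G v) W B"
  using assms by (intro shape_le_properI) auto

lemma image_shape:
  assumes sh: "emb_shape G W B"
  shows "inj_on p0 B" "emb_shape G' (V W) (p0 ` B)"
proof -
  have "inj_on p0 B \<and> emb_shape G' (V W) (p0 ` B)"
  proof (cases "W = {}")
    case True
    then consider "B = {}" "nodeless_loop G" | a where "a \<in> arcs G" "B = {a, dag G a}"
      using sh by (auto simp: emb_shape_empty_iff)
    then show ?thesis
    proof cases
      case 1
      \<comment> \<open>A nodeless loop has no boundary and no vertices, so the premise of (c')
        holds vacuously.\<close>
      then have "nodeless_loop G'"
        using p1_loop by (auto simp: nodeless_loop_def)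
      then show ?thesis
        using 1 True by (simp add: V_def emb_shape_empty_iff)
    next
      case 2
      then show ?thesis
        using True p0[OF 2(1)] connected_extD(6)[OF G', of "p0 a"] emb_shape_edge
        by (auto simp: V_def)
    qed
  next
    case False
    then obtain v where v: "v \<in> W" by blast
    then have "v \<in> verts G"
      using emb_shape_subset(1)[OF G sh] by blast
    then show ?thesis
      using proper_image[OF sh emb_shape_star _ star_le[OF False v] p0_inj_nb star_image_shape]
      by blast
  qed
  then show "inj_on p0 B" "emb_shape G' (V W) (p0 ` B)"
    by auto
qed

lemma image_shape_le:
  assumes sh1: "emb_shape G W1 B1" and sh2: "emb_shape G W2 B2" and le: "shape_le G W1 B1 W2 B2"
  shows "shape_le G' (V W1) (p0 ` B1) (V W2) (p0 ` B2)"
proof (cases "W1 = {}")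
  case False
  then show ?thesis
    using proper_image[OF sh2 sh1 _ le] image_shape[OF sh1] by blast
next
  case True
  then consider "B1 = {}" | a where "a \<in> arcs G" "B1 = {a, dag G a}"
    using sh1 by (auto simp: emb_shape_empty_iff)
  then show ?thesis
  proof cases
    case 1
    then show ?thesis
      using le True shape_le_refl by (auto simp: shape_le_def)
  next
    case 2
    have im1: "p0 ` B1 = {p0 a, dag G' (p0 a)}" "V W1 = {}"
      using p0[OF 2(1)] 2(2) True by (auto simp: V_def)
    have sup: "{a, dag G a} \<subseteq> support G W2 B2"
      using le True 2(2) by (simp add: shape_le_def support_def)
    show ?thesis
    proof (cases "W2 = {}")
      case W2: True
      show ?thesis
      proof (cases "B2 = {}")
        case True
        then show ?thesis
          using W2 im1 p0[OF 2(1)] connected_extD(5)[OF G']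
          by (auto simp: shape_le_def V_def inner_def arcs_at_def support_def)
      next
        case False
        then have "a \<in> B2"
          using sup W2 by (simp add: support_def)
        then have "B2 = B1"
          using emb_shape_edgeD(1)[OF G] sh2 W2 2(2) by metis
        then show ?thesis
          using W2 True shape_le_refl by metis
      qed
    next
      case False
      \<comment> \<open>The edge ends at some vertex of \<open>W2\<close>. It lies below the star of
        that vertex, and its image is compared with that of \<open>W2\<close> through the image of
        the star.\<close>
      then have "a \<in> arcs_at G W2 \<or> dag G a \<in> arcs_at G W2"
        using sup mem_dag_image_arcs_at(2)[OF G, of a W2] by (auto simp: support_def)
      then obtain y where y: "y \<in> arcs_at G W2" "y \<in> arcs G" "B1 = {dag G y, y}"
        using 2 connected_extD(5,7)[OF G 2(1)] by (metis insert_commute)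
      define v where "v = tgt G y"
      have v: "v \<in> W2" "v \<in> verts G" "dag G y \<in> dag G ` nb G v"
        using y connected_extD(9)[OF G] by (auto simp: v_def arcs_at_def nb_def)
      have "p0 ` B1 = {p0 (dag G y), dag G' (p0 (dag G y))}"
        using y p0(2)[of "dag G y"] connected_extD(5,7)[OF G y(2)] by auto
      then have "shape_le G' {} (p0 ` B1) (V {v}) (p0 ` dag G ` nb G v)"
        using edge_shape_le(1)[OF G' star_image_shape[OF v(2)], of "p0 (dag G y)"] v(3) by auto
      moreover have "shape_le G' (V {v}) (p0 ` dag G ` nb G v) (V W2) (p0 ` B2)"
        using proper_image[OF sh2 emb_shape_star[OF v(2)] _ star_le[OF False v(1)]
            p0_inj_nb[OF v(2)] star_image_shape[OF v(2)]] by blast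
      ultimately show ?thesis
        using shape_le_trans im1(2) by metis
    qed
  qed
qed

lemma extend_graphical_apply:
  assumes "h \<in> Emb G"
  defines "c \<equiv> snd (extend_graphical G G' (p0, p1)) h"
  shows "c \<in> Emb G'" "emb_verts c = V (emb_verts h)" "emb_bdy c = p0 ` emb_bdy h"
  using shape_class[OF G' image_shape(2)[OF Emb_shape[OF assms(1)]]] assms(1)
  by (auto simp: c_def extend_graphical_def V_def)

lemma extend_graphical_mem: "extend_graphical G G' (p0, p1) \<in> new_graph_maps G G'"
proof -
  define q where "q = snd (extend_graphical G G' (p0, p1))"
  note ap = extend_graphical_apply[folded q_def]
  have "p0 \<in> involutive_funs G G'"
    using mem_iff by blast
  moreover have "q \<in> Emb G \<rightarrow>\<^sub>E Emb G'"
    using ap(1) by (auto simp: q_def extend_graphical_def)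
  moreover have "is_edge (q h)" if "h \<in> Emb G" "is_edge h" for h
    using that ap[OF that(1)] is_edge_iff[OF that(1)] is_edge_iff[OF ap(1)[OF that(1)]]
    by (simp add: V_def)
  moreover have "emb_union (q l) (q h) (q k)"
    if "l \<in> Emb G" "h \<in> Emb G" "k \<in> Emb G" "emb_union l h k" for l h k
  proof -
    have "emb_le (q h) (q l)" if "h \<in> Emb G" "emb_le h l" for h
      using that ap \<open>l \<in> Emb G\<close> image_shape_le[OF Emb_shape Emb_shape]
      by (simp add: emb_le_iff[where G = G] emb_le_iff[where G = G'])
    then show ?thesis
      using that ap by (auto simp: emb_union_def V_def)
  qed
  moreover have "vertex_disjoint (q h) (q k)"
    if "h \<in> Emb G" "k \<in> Emb G" "vertex_disjoint h k" for h k
  proof -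
    have "emb_verts (p1 v) \<inter> emb_verts (p1 w) = {}" if "v \<in> emb_verts h" "w \<in> emb_verts k" for v w
      using that \<open>vertex_disjoint h k\<close> emb_shape_subset(1)[OF G Emb_shape] \<open>h \<in> Emb G\<close> \<open>k \<in> Emb G\<close>
      unfolding vertex_disjoint_def by (intro p1_disjoint) auto
    then show ?thesis
      using ap that unfolding vertex_disjoint_def V_def by auto
  qed
  moreover have "mset_set (emb_bdy (q h)) = image_mset p0 (mset_set (emb_bdy h))" if "h \<in> Emb G" for h
    using ap[OF that] image_shape(1)[OF Emb_shape[OF that]] by (simp add: image_mset_mset_set)
  ultimately have "(p0, q) \<in> new_graph_maps G G'"
    by (simp add: new_graph_maps_def)
  then show ?thesis
    by (simp add: q_def extend_graphical_def)
qed

lemma restrict_extend: "restrict_new G (extend_graphical G G' (p0, p1)) = (p0, p1)"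
proof -
  have "snd (extend_graphical G G' (p0, p1)) (star_class G v) = p1 v" if v: "v \<in> verts G" for v
    using shape_class[OF G emb_shape_star[OF v]] extend_graphical_apply[of "star_class G v"]
      p1[OF v] p1_bdy[OF v] by (intro Emb_eqI[of _ G']) (auto simp: V_def)
  moreover have "p1 \<in> extensional (verts G)"
    using mem_iff by (simp add: PiE_def)
  ultimately show ?thesis
    by (auto simp: restrict_new_def extend_graphical_def extensional_def restrict_def fun_eq_iff)
qed

end

text \<open>The shape of the identity. When \<open>bdy G = {}\<close>, it supplies the closed class
  on which (c') is tested.\<close>

lemma emb_shape_total:
  assumes "connected_ext G"
  shows "emb_shape G (verts G) (bdy G)"
proof -
  have "embedding G G (id, id)"
    using assms by (auto simp: embedding_def etale_def)
  from embedding_shape[OF this] show ?thesis by simp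
qed

section \<open>Restricting new graph maps to stars\<close>

locale new_graph_map =
  fixes G :: "('a, 'v) ugraph" and G' :: "('b, 'w) ugraph" and p0 q
  assumes G: "connected_ext G" and G': "connected_ext G'"
    and mem: "(p0, q) \<in> new_graph_maps G G'"
begin

lemma p0: "p0 \<in> involutive_funs G G'"
  and q_ext: "q \<in> Emb G \<rightarrow>\<^sub>E Emb G'"
  and q: "h \<in> Emb G \<Longrightarrow> q h \<in> Emb G'"
  and q_edge: "h \<in> Emb G \<Longrightarrow> is_edge h \<Longrightarrow> is_edge (q h)"
  and q_union: "\<lbrakk>l \<in> Emb G; h \<in> Emb G; k \<in> Emb G; emb_union l h k\<rbrakk> \<Longrightarrow> emb_union (q l) (q h) (q k)"
  and q_disjoint: "\<lbrakk>h \<in> Emb G; k \<in> Emb G; vertex_disjoint h k\<rbrakk> \<Longrightarrow> vertex_disjoint (q h) (q k)"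
  and q_mset: "h \<in> Emb G \<Longrightarrow> mset_set (emb_bdy (q h)) = image_mset p0 (mset_set (emb_bdy h))"
  using mem by (auto simp: new_graph_maps_def)

text \<open>The multiset equation (iv) contains both claims: the underlying sets give the image, and
  the sizes give injectivity because the boundary of the value has no repetitions.\<close>

lemma q_bdy:
  assumes h: "h \<in> Emb G"
  shows "inj_on p0 (emb_bdy h)" "emb_bdy (q h) = p0 ` emb_bdy h"
proof -
  note fin = finite_emb_bdy[OF G h] and fin' = finite_emb_bdy[OF G' q[OF h]]
  have "set_mset (mset_set (emb_bdy (q h))) = p0 ` emb_bdy h"
    using q_mset[OF h] fin by simp
  then show im: "emb_bdy (q h) = p0 ` emb_bdy h"
    using fin' by simp
  have "size (mset_set (emb_bdy (q h))) = size (mset_set (emb_bdy h))"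
    using q_mset[OF h] by simp
  then show "inj_on p0 (emb_bdy h)"
    using im fin by (simp add: eq_card_imp_inj_on)
qed

lemma star_class:
  assumes "v \<in> verts G"
  shows "star_class G v \<in> Emb G" "emb_verts (star_class G v) = {v}"
    "emb_bdy (star_class G v) = dag G ` nb G v"
  using shape_class[OF G emb_shape_star[OF assms]] .

text \<open>Together with \<open>q_bdy\<close> this shows that the values on stars determine
  \<open>q\<close>.\<close>

lemma q_verts:
  assumes h: "h \<in> Emb G"
  shows "emb_verts (q h) = (\<Union>v\<in>emb_verts h. emb_verts (q (star_class G v)))"
proof (cases "emb_verts h = {}")
  case True
  have "emb_verts (q h) = {}"
  proof (cases "emb_bdy h = {}")
    case False
    then show ?thesis
      using True is_edge_iff[OF h] is_edge_iff[OF q[OF h]] q_edge[OF h] by blast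
  next
    case bdy: True
    then have "nodeless_loop G"
      using Emb_shape[OF h] True by (simp add: emb_shape_empty_iff)
    then obtain a where a: "a \<in> arcs G"
      unfolding nodeless_loop_def by blast
    \<comment> \<open>The identity of a nodeless loop is a union of its edge with itself, so
      preservation of unions and of edges leaves its value without vertices.\<close>
    let ?e = "shape_class G {} {a, dag G a}"
    note e = shape_class[OF G emb_shape_edge[OF a]]
    have "shape_le G {} {a, dag G a} {} {}"
      using a connected_extD(5)[OF G a] by (simp add: shape_le_def inner_def arcs_at_def support_def)
    then have "emb_union h ?e ?e"
      using e True bdy by (simp add: emb_union_def emb_le_iff[OF e(1) h])
    then have "emb_verts (q h) = emb_verts (q ?e)"
      using q_union[OF h e(1) e(1)] by (simp add: emb_union_def)
    moreover have "is_edge (q ?e)"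
      using q_edge[OF e(1)] is_edge_iff[OF e(1)] e by simp
    ultimately show ?thesis
      using is_edge_iff[OF q[OF e(1)]] by simp
  qed
  then show ?thesis
    using True by simp
next
  case False
  then obtain v where v: "v \<in> emb_verts h" by blast
  then have vG: "v \<in> verts G"
    using emb_shape_subset(1)[OF G Emb_shape[OF h]] by blast
  \<comment> \<open>The induction runs over pairs of a vertex set and a boundary, so the claim is
    phrased for every class with these data.\<close>
  have "\<forall>c\<in>Emb G. emb_verts c = emb_verts h \<longrightarrow> emb_bdy c = emb_bdy h \<longrightarrow>
      emb_verts (q c) = (\<Union>v\<in>emb_verts h. emb_verts (q (star_class G v)))"
  proof (rule proper_shape_induct[OF G Emb_shape[OF h] emb_shape_star[OF vG]])
    show "shape_le G {v} (dag G ` nb G v) (emb_verts h) (emb_bdy h)"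
      using v by (intro shape_le_properI) auto
    show "\<forall>c\<in>Emb G. emb_verts c = {v} \<longrightarrow> emb_bdy c = dag G ` nb G v \<longrightarrow>
        emb_verts (q c) = (\<Union>v\<in>{v}. emb_verts (q (star_class G v)))"
      using shape_class_eqI[OF G] by auto
  next
    fix U C x
    assume sh: "emb_shape G U C" and ne: "U \<noteq> {}" and x: "x \<in> C" "dag G x \<in> C"
      and IH: "\<forall>c\<in>Emb G. emb_verts c = U \<longrightarrow> emb_bdy c = C \<longrightarrow>
          emb_verts (q c) = (\<Union>v\<in>U. emb_verts (q (star_class G v)))"
    note d = shape_class[OF G sh]
    show "\<forall>c\<in>Emb G. emb_verts c = U \<longrightarrow> emb_bdy c = C - {x, dag G x} \<longrightarrow>
        emb_verts (q c) = (\<Union>v\<in>U. emb_verts (q (star_class G v)))"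
    proof (intro ballI impI)
      fix c assume c: "c \<in> Emb G" "emb_verts c = U" "emb_bdy c = C - {x, dag G x}"
      have "emb_union c (shape_class G U C) (shape_class G U C)"
        using emb_shape_glue_self(2)[OF G sh x] ne c d by (simp add: emb_union_def emb_le_iff)
      then have "emb_verts (q c) = emb_verts (q (shape_class G U C))"
        using q_union[OF c(1) d(1) d(1)] by (simp add: emb_union_def)
      then show "emb_verts (q c) = (\<Union>v\<in>U. emb_verts (q (star_class G v)))"
        using IH d by auto
    qed
  next
    fix U C v x
    assume sh: "emb_shape G U C" and v: "v \<in> verts G" "v \<notin> U"
      and x: "x \<in> C" "dag G x \<in> dag G ` nb G v"
      and IH: "\<forall>c\<in>Emb G. emb_verts c = U \<longrightarrow> emb_bdy c = C \<longrightarrow>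
          emb_verts (q c) = (\<Union>v\<in>U. emb_verts (q (star_class G v)))"
    note d = shape_class[OF G sh] and e = star_class[OF v(1)]
    show "\<forall>c\<in>Emb G. emb_verts c = U \<union> {v} \<longrightarrow>
        emb_bdy c = C - {x} \<union> (dag G ` nb G v - {dag G x}) \<longrightarrow>
        emb_verts (q c) = (\<Union>v\<in>U \<union> {v}. emb_verts (q (star_class G v)))"
    proof (intro ballI impI)
      fix c assume c: "c \<in> Emb G" "emb_verts c = U \<union> {v}"
        "emb_bdy c = C - {x} \<union> (dag G ` nb G v - {dag G x})"
      have "emb_union c (shape_class G U C) (star_class G v)"
        using emb_shape_glue(2,3)[OF G sh emb_shape_star[OF v(1)] _ x] v(2) c d e
        by (simp add: emb_union_def emb_le_iff)
      then have "emb_verts (q c) = emb_verts (q (shape_class G U C)) \<union> emb_verts (q (star_class G v))"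
        using q_union[OF c(1) d(1) e(1)] by (simp add: emb_union_def)
      then show "emb_verts (q c) = (\<Union>v\<in>U \<union> {v}. emb_verts (q (star_class G v)))"
        using IH d by auto
    qed
  qed (use False in auto)
  then show ?thesis
    using h by blast
qed

lemma restrict_new_mem: "restrict_new G (p0, q) \<in> graphical_maps_Ut G G'"
proof -
  define p1 where "p1 = (\<lambda>v\<in>verts G. q (star_class G v))"
  have "p1 \<in> verts G \<rightarrow>\<^sub>E Emb G'"
    using q star_class(1) by (auto simp: p1_def)
  moreover have "emb_verts (p1 v) \<inter> emb_verts (p1 w) = {}"
    if "v \<in> verts G" "w \<in> verts G" "v \<noteq> w" for v w
    using q_disjoint[OF star_class(1) star_class(1)] that star_class(2)
    by (simp add: p1_def vertex_disjoint_def)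
  moreover have "inj_on p0 (dag G ` nb G v)" "emb_bdy (p1 v) = p0 ` dag G ` nb G v"
    if "v \<in> verts G" for v
    using q_bdy[OF star_class(1)[OF that]] star_class(3)[OF that] that by (auto simp: p1_def)
  moreover have "nodeless_loop G'" if bdy: "bdy G = {}" and "\<And>v. v \<in> verts G \<Longrightarrow> emb_verts (p1 v) = {}"
  proof -
    \<comment> \<open>The value of such a class has neither vertices nor boundary, which is possible
      only in a nodeless loop.\<close>
    obtain h where h: "h \<in> Emb G" "emb_bdy h = {}"
      using shape_class[OF G emb_shape_total[OF G]] bdy by metis
    have "emb_verts (q h) = {}"
      using q_verts[OF h(1)] that(2) emb_shape_subset(1)[OF G Emb_shape[OF h(1)]]
      by (auto simp: p1_def)
    moreover have "emb_bdy (q h) = {}"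
      using q_bdy(2)[OF h(1)] h(2) by simp
    ultimately show ?thesis
      using Emb_shape[OF q[OF h(1)]] by (simp add: emb_shape_empty_iff)
  qed
  ultimately have "(p0, p1) \<in> graphical_maps_Ut G G'"
    unfolding graphical_maps_Ut_iff[OF G G'] using p0 by simp
  then show ?thesis
    by (simp add: restrict_new_def p1_def)
qed

lemma extend_restrict: "extend_graphical G G' (restrict_new G (p0, q)) = (p0, q)"
proof -
  have "shape_class G' (\<Union>v\<in>emb_verts h. emb_verts (snd (restrict_new G (p0, q)) v)) (p0 ` emb_bdy h) = q h"
    if h: "h \<in> Emb G" for h
  proof (rule shape_class_eqI[OF G' q[OF h]])
    have "emb_verts h \<subseteq> verts G"
      using emb_shape_subset(1)[OF G Emb_shape[OF h]] .
    then show "emb_verts (q h) = (\<Union>v\<in>emb_verts h. emb_verts (snd (restrict_new G (p0, q)) v))"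
      unfolding q_verts[OF h] by (intro SUP_cong) (auto simp: restrict_new_def)
  qed (use q_bdy h in auto)
  then show ?thesis
    using q_ext unfolding extend_graphical_def
    by (auto simp: restrict_new_def restrict_def fun_eq_iff PiE_def extensional_def)
qed

end

section \<open>The bijection and its compatibility with composition\<close>

lemma extend_graphical_bij:
  assumes G: "connected_ext G" and G': "connected_ext G'"
  shows "bij_betw (extend_graphical G G') (graphical_maps_Ut G G') (new_graph_maps G G')"
proof (rule bij_betw_byWitness[where f' = "restrict_new G"])
  have g: "graphical_map G G' (fst p) (snd p)" if "p \<in> graphical_maps_Ut G G'" for p
    using that G G' by (simp add: graphical_map_def)
  have n: "new_graph_map G G' (fst p) (snd p)" if "p \<in> new_graph_maps G G'" for p
    using that G G' by (simp add: new_graph_map_def)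
  show "\<forall>p\<in>graphical_maps_Ut G G'. restrict_new G (extend_graphical G G' p) = p"
    using graphical_map.restrict_extend[OF g] by simp
  show "\<forall>p\<in>new_graph_maps G G'. extend_graphical G G' (restrict_new G p) = p"
    using new_graph_map.extend_restrict[OF n] by simp
  show "extend_graphical G G' ` graphical_maps_Ut G G' \<subseteq> new_graph_maps G G'"
    using graphical_map.extend_graphical_mem[OF g] by auto
  show "restrict_new G ` new_graph_maps G G' \<subseteq> graphical_maps_Ut G G'"
    using new_graph_map.restrict_new_mem[OF n] by auto
qed

lemma new_comp_mem:
  assumes "p \<in> new_graph_maps G G'" and "q \<in> new_graph_maps G' G''"
    and G: "connected_ext G"
  shows "new_comp G q p \<in> new_graph_maps G G''"
proof -
  obtain p0 p' q0 q' where pq: "p = (p0, p')" "q = (q0, q')" by (cases p, cases q)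
  have p': "p' h \<in> Emb G'" if "h \<in> Emb G" for h
    using assms(1) that pq by (auto simp: new_graph_maps_def)
  have "image_mset (compose (arcs G) q0 p0) (mset_set (emb_bdy h)) =
      image_mset q0 (image_mset p0 (mset_set (emb_bdy h)))" if "h \<in> Emb G" for h
    unfolding image_mset.compositionality
    using finite_emb_bdy[OF G that] emb_shape_subset(2)[OF G Emb_shape[OF that]]
    by (intro image_mset_cong) (auto simp: compose_def)
  moreover have "compose (arcs G) q0 p0 \<in> involutive_funs G G''"
    using assms pq connected_extD(5)[OF G]
    by (auto simp: new_graph_maps_def involutive_funs_def compose_def)
  moreover have "compose (Emb G) q' p' \<in> Emb G \<rightarrow>\<^sub>E Emb G''"
    using assms(2) p' pq by (auto simp: new_graph_maps_def compose_def)
  ultimately show ?thesis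
    using assms(1,2) p' unfolding pq
    by (simp add: new_graph_maps_def new_comp_def compose_eq)
qed

text \<open>The class chosen in \<open>graphical_comp\<close> at \<open>v\<close> is the value of
  the extension of \<open>q\<close> at \<open>snd p v\<close>, and \<open>snd p v\<close> is the
  value of the extension of \<open>p\<close> on the star of \<open>v\<close>. Closure and
  functoriality are thereby inherited from composition of functions.\<close>

lemma graphical_comp_eq:
  assumes G: "connected_ext G" and G': "connected_ext G'" and G'': "connected_ext G''"
    and p: "p \<in> graphical_maps_Ut G G'" and q: "q \<in> graphical_maps_Ut G' G''"
  shows "graphical_comp G G'' q p =
    restrict_new G (new_comp G (extend_graphical G' G'' q) (extend_graphical G G' p))"
proof -
  interpret p: graphical_map G G' "fst p" "snd p"
    using p G G' by (simp add: graphical_map_def)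
  have star: "snd (extend_graphical G G' p) (star_class G v) = snd p v" if "v \<in> verts G" for v
  proof -
    have "snd (restrict_new G (extend_graphical G G' p)) v = snd p v"
      using p.restrict_extend by simp
    then show ?thesis
      using that by (simp add: restrict_new_def)
  qed
  have "snd (extend_graphical G' G'' q) (snd p v) =
      snd (new_comp G (extend_graphical G' G'' q) (extend_graphical G G' p)) (star_class G v)"
    if "v \<in> verts G" for v
    using shape_class(1)[OF G emb_shape_star[OF that]] star[OF that]
    by (simp add: new_comp_def compose_eq)
  then show ?thesis
    using p.p1
    by (intro prod_eqI ext)
      (simp_all add: graphical_comp_def restrict_new_def restrict_def shape_class_def new_comp_def
        extend_graphical_def)
qed

lemma extend_graphical_comp:
  assumes G: "connected_ext G" and G': "connected_ext G'" and G'': "connected_ext G''"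
    and p: "p \<in> graphical_maps_Ut G G'" and q: "q \<in> graphical_maps_Ut G' G''"
  shows "graphical_comp G G'' q p \<in> graphical_maps_Ut G G''"
    and "extend_graphical G G'' (graphical_comp G G'' q p) =
      new_comp G (extend_graphical G' G'' q) (extend_graphical G G' p)"
proof -
  let ?c = "new_comp G (extend_graphical G' G'' q) (extend_graphical G G' p)"
  have "extend_graphical G G' p \<in> new_graph_maps G G'"
    "extend_graphical G' G'' q \<in> new_graph_maps G' G''"
    using p q extend_graphical_bij[OF G G'] extend_graphical_bij[OF G' G''] by (auto simp: bij_betw_def)
  then have "?c \<in> new_graph_maps G G''"
    using new_comp_mem G by blast
  then interpret c: new_graph_map G G'' "fst ?c" "snd ?c"
    using G G'' by (simp add: new_graph_map_def)
  show "graphical_comp G G'' q p \<in> graphical_maps_Ut G G''"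
    "extend_graphical G G'' (graphical_comp G G'' q p) = ?c"
    unfolding graphical_comp_eq[OF assms] using c.restrict_new_mem c.extend_restrict by auto
qed

theorem theorem1:
  shows "\<exists>\<Phi> :: ('a, 'v) ugraph \<Rightarrow> ('a, 'v) ugraph \<Rightarrow>
                 ('a, 'v, 'a, 'v) graphical \<Rightarrow> ('a, 'v, 'a, 'v) new_map.
    \<forall>(Ob, Mor) \<in> {(Collect connected_ordinary, graphical_maps_U),
                    (Collect connected_ext, graphical_maps_Ut)}.
      (\<forall>G\<in>Ob. \<forall>G'\<in>Ob.
         bij_betw (\<Phi> G G') (Mor G G') (new_graph_maps G G') \<and>
         (\<forall>\<phi>\<in>Mor G G'. fst (\<Phi> G G' \<phi>) = fst \<phi>)) \<and>
      (\<forall>G\<in>Ob. \<forall>G'\<in>Ob. \<forall>G''\<in>Ob. \<forall>\<phi>\<in>Mor G G'. \<forall>\<psi>\<in>Mor G' G''.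
         graphical_comp G G'' \<psi> \<phi> \<in> Mor G G'' \<and>
         \<Phi> G G'' (graphical_comp G G'' \<psi> \<phi>) = new_comp G (\<Phi> G' G'' \<psi>) (\<Phi> G G' \<phi>))"
proof (rule exI[of _ extend_graphical])
  have ext: "connected_ext G" if "connected_ordinary G" for G :: "('a, 'v) ugraph"
    using that by (simp add: connected_ext_def)
  have fst: "fst (extend_graphical G G' \<phi>) = fst \<phi>" for G G' and \<phi> :: "('a, 'v, 'a, 'v) graphical"
    by (simp add: extend_graphical_def)
  show "\<forall>(Ob, Mor) \<in> {(Collect connected_ordinary, graphical_maps_U),
                    (Collect connected_ext, graphical_maps_Ut)}.
      (\<forall>G\<in>Ob. \<forall>G'\<in>Ob.
         bij_betw (extend_graphical G G') (Mor G G') (new_graph_maps G G') \<and>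
         (\<forall>\<phi>\<in>Mor G G'. fst (extend_graphical G G' \<phi>) = fst \<phi>)) \<and>
      (\<forall>G\<in>Ob. \<forall>G'\<in>Ob. \<forall>(G'' :: ('a, 'v) ugraph)\<in>Ob. \<forall>\<phi>\<in>Mor G G'. \<forall>\<psi>\<in>Mor G' G''.
         graphical_comp G G'' \<psi> \<phi> \<in> Mor G G'' \<and>
         extend_graphical G G'' (graphical_comp G G'' \<psi> \<phi>) =
           new_comp G (extend_graphical G' G'' \<psi>) (extend_graphical G G' \<phi>))"
    unfolding ball_simps prod.case mem_Collect_eq fst
    by (auto simp: graphical_maps_U_eq ext extend_graphical_bij)
      (blast intro: ext extend_graphical_comp)+
qed

end
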